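(* Let $(R,\mathfrak m)$ be a (Noetherian) local domain with a big Cohen-Macaulay $R$-module $B$ such that $\tau_B(R)=R$ (or $\tau^{\mathrm{fg}}_B(R)=R$). Then $R$ is Cohen-Macaulay.
   Context: A big Cohen-Macaulay $R$-module is an $R$-module $B$ (not necessarily finitely generated) with $\mathfrak mB\neq B$ such that every system of parameters of $R$ is a regular sequence on $B$. For an $R$-module $B$, the module closure $\mathrm{cl}_B$ assigns to $R$-modules $N\subseteq M$ the submodule $N_M^{\mathrm{cl}_B}=\{u\in M: b\otimes u\in\operatorname{Im}(B\otimes_R N\to B\otimes_R M)\text{ for all } b\in B\}$. The test ideal is $\tau_B(R)=\bigcap_{N\subseteq M}(N:_R N_M^{\mathrm{cl}_B})$ over all $R$-modules $N\subseteq M$; the finitistic test ideal $\tau^{\mathrm{fg}}_B(R)$ is the same intersection over those $N\subseteq M$ with $M/N$ finitely generated. *)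

theory Defs
  imports "HOL-Algebra.Algebra" "HOL-Library.Extended_Nat"
begin

section \<open>Noetherian local rings, dimension, systems of parameters\<close>

locale noetherian_local_ring = noetherian_ring R + cring R for R (structure) +
  fixes \<mm>
  assumes maximalideal_mm: "maximalideal \<mm> R"
    and unique_maximalideal: "\<And>J. maximalideal J R \<Longrightarrow> J = \<mm>"

definition krull_dim :: "('a, 'c) ring_scheme \<Rightarrow> enat" where
  "krull_dim R =
     Sup {enat n | n. \<exists>P :: nat \<Rightarrow> 'a set.
            (\<forall>i\<le>n. primeideal (P i) R) \<and> (\<forall>i<n. P i \<subset> P (Suc i))}"

definition ideal_radical :: "('a, 'c) ring_scheme \<Rightarrow> 'a set \<Rightarrow> 'a set" where
  "ideal_radical R I = {a \<in> carrier R. \<exists>k::nat. a [^]\<^bsub>R\<^esub> k \<in> I}"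

text \<open>A system of parameters consists of \<open>dim R\<close> elements generating an
  \<open>\<mm>\<close>-primary ideal; since \<open>\<mm>\<close> is maximal, the latter means that the radical is \<open>\<mm>\<close>.\<close>

definition system_of_parameters :: "('a, 'c) ring_scheme \<Rightarrow> 'a set \<Rightarrow> 'a list \<Rightarrow> bool" where
  "system_of_parameters R \<mm> xs \<longleftrightarrow>
     set xs \<subseteq> \<mm> \<and> enat (length xs) = krull_dim R \<and>
     ideal_radical R (genideal R (set xs)) = \<mm>"


section \<open>Modules\<close>

definition submodule_span ::
    "('a, 'c) ring_scheme \<Rightarrow> ('a, 'm, 'd) module_scheme \<Rightarrow> 'm set \<Rightarrow> 'm set" where
  "submodule_span R M S = \<Inter>{N. submodule N R M \<and> S \<subseteq> N}"

definition ideal_smult ::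
    "('a, 'c) ring_scheme \<Rightarrow> ('a, 'm, 'd) module_scheme \<Rightarrow> 'a set \<Rightarrow> 'm set" where
  "ideal_smult R M I = submodule_span R M {a \<odot>\<^bsub>M\<^esub> m | a m. a \<in> I \<and> m \<in> carrier M}"

definition fin_gen_module :: "('a, 'c) ring_scheme \<Rightarrow> ('a, 'm, 'd) module_scheme \<Rightarrow> bool" where
  "fin_gen_module R M \<longleftrightarrow>
     (\<exists>S. finite S \<and> S \<subseteq> carrier M \<and> submodule_span R M S = carrier M)"

text \<open>A module record extends a ring record, but the locale \<^locale>\<open>module\<close> ignores the fields
  \<open>mult\<close> and \<open>one\<close>; they are left unspecified in the quotient.\<close>

definition quotient_module :: "('a, 'm, 'd) module_scheme \<Rightarrow> 'm set \<Rightarrow> ('a, 'm set) module" where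
  "quotient_module M N =
     \<lparr>carrier = a_rcosets\<^bsub>M\<^esub> N, monoid.mult = undefined, monoid.one = undefined,
      ring.zero = N, ring.add = (<+>\<^bsub>M\<^esub>),
      module.smult = (\<lambda>r C. \<Union>x\<in>C. N +>\<^bsub>M\<^esub> (r \<odot>\<^bsub>M\<^esub> x))\<rparr>"

definition ring_as_module :: "('a, 'c) ring_scheme \<Rightarrow> ('a, 'a) module" where
  "ring_as_module R =
     \<lparr>carrier = carrier R, monoid.mult = (\<otimes>\<^bsub>R\<^esub>), monoid.one = \<one>\<^bsub>R\<^esub>,
      ring.zero = \<zero>\<^bsub>R\<^esub>, ring.add = (\<oplus>\<^bsub>R\<^esub>), module.smult = (\<otimes>\<^bsub>R\<^esub>)\<rparr>"


section \<open>Regular sequences, depth, Cohen-Macaulay rings and modules\<close>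

text \<open>The condition on \<open>xs ! i\<close> says that it is a nonzerodivisor on
  \<open>M / (xs ! 0, \<dots>, xs ! (i - 1)) M\<close>.\<close>

definition regular_sequence ::
    "('a, 'c) ring_scheme \<Rightarrow> ('a, 'm, 'd) module_scheme \<Rightarrow> 'a list \<Rightarrow> bool" where
  "regular_sequence R M xs \<longleftrightarrow>
     set xs \<subseteq> carrier R \<and>
     (\<forall>i<length xs. \<forall>m\<in>carrier M.
        (xs ! i) \<odot>\<^bsub>M\<^esub> m \<in> ideal_smult R M (genideal R (set (take i xs))) \<longrightarrow>
        m \<in> ideal_smult R M (genideal R (set (take i xs)))) \<and>
     ideal_smult R M (genideal R (set xs)) \<noteq> carrier M"

definition local_depth :: "('a, 'c) ring_scheme \<Rightarrow> 'a set \<Rightarrow> enat" where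
  "local_depth R \<mm> =
     Sup {enat (length xs) | xs. set xs \<subseteq> \<mm> \<and> regular_sequence R (ring_as_module R) xs}"

definition cohen_macaulay_local :: "('a, 'c) ring_scheme \<Rightarrow> 'a set \<Rightarrow> bool" where
  "cohen_macaulay_local R \<mm> \<longleftrightarrow> noetherian_local_ring R \<mm> \<and> local_depth R \<mm> = krull_dim R"

definition big_cohen_macaulay ::
    "('a, 'c) ring_scheme \<Rightarrow> 'a set \<Rightarrow> ('a, 'b, 'd) module_scheme \<Rightarrow> bool" where
  "big_cohen_macaulay R \<mm> B \<longleftrightarrow>
     module R B \<and> ideal_smult R B \<mm> \<noteq> carrier B \<and>
     (\<forall>xs. system_of_parameters R \<mm> xs \<longrightarrow> regular_sequence R B xs)"


section \<open>Tensor products\<close>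

text \<open>Only the additive group of \<open>B \<otimes>\<^sub>R M\<close> is constructed: the free abelian group on pairs,
  modulo biadditivity and \<open>R\<close>-balancedness. Module closures do not refer to the scalar
  multiplication of a tensor product.\<close>

definition tensor_relations ::
    "('a, 'c) ring_scheme \<Rightarrow> ('a, 'b, 'd) module_scheme \<Rightarrow> ('a, 'm, 'e) module_scheme
      \<Rightarrow> ('b \<times> 'm \<Rightarrow>\<^sub>0 int) set" where
  "tensor_relations R B M =
     generate (free_Abelian_group (carrier B \<times> carrier M))
      ({frag_of (b \<oplus>\<^bsub>B\<^esub> b', m) - frag_of (b, m) - frag_of (b', m) | b b' m.
          b \<in> carrier B \<and> b' \<in> carrier B \<and> m \<in> carrier M} \<union>
       {frag_of (b, m \<oplus>\<^bsub>M\<^esub> m') - frag_of (b, m) - frag_of (b, m') | b m m'.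
          b \<in> carrier B \<and> m \<in> carrier M \<and> m' \<in> carrier M} \<union>
       {frag_of (r \<odot>\<^bsub>B\<^esub> b, m) - frag_of (b, r \<odot>\<^bsub>M\<^esub> m) | r b m.
          r \<in> carrier R \<and> b \<in> carrier B \<and> m \<in> carrier M})"

definition tensor_product ::
    "('a, 'c) ring_scheme \<Rightarrow> ('a, 'b, 'd) module_scheme \<Rightarrow> ('a, 'm, 'e) module_scheme
      \<Rightarrow> ('b \<times> 'm \<Rightarrow>\<^sub>0 int) set monoid" where
  "tensor_product R B M =
     free_Abelian_group (carrier B \<times> carrier M) Mod tensor_relations R B M"

definition tensor_class ::
    "('a, 'c) ring_scheme \<Rightarrow> ('a, 'b, 'd) module_scheme \<Rightarrow> ('a, 'm, 'e) module_scheme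
      \<Rightarrow> ('b \<times> 'm \<Rightarrow>\<^sub>0 int) \<Rightarrow> ('b \<times> 'm \<Rightarrow>\<^sub>0 int) set" where
  "tensor_class R B M x =
     tensor_relations R B M #>\<^bsub>free_Abelian_group (carrier B \<times> carrier M)\<^esub> x"

definition pure_tensor ::
    "('a, 'c) ring_scheme \<Rightarrow> ('a, 'b, 'd) module_scheme \<Rightarrow> ('a, 'm, 'e) module_scheme
      \<Rightarrow> 'b \<Rightarrow> 'm \<Rightarrow> ('b \<times> 'm \<Rightarrow>\<^sub>0 int) set" where
  "pure_tensor R B M b m = tensor_class R B M (frag_of (b, m))"

text \<open>The map \<open>id \<otimes> f : B \<otimes> N \<rightarrow> B \<otimes> M\<close> induced by a linear map \<open>f : N \<rightarrow> M\<close>. All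
  representatives \<open>x\<close> of a class \<open>C\<close> have the same image, so the union is a single class.\<close>

definition tensor_map ::
    "('a, 'c) ring_scheme \<Rightarrow> ('a, 'b, 'd) module_scheme \<Rightarrow> ('a, 'm, 'e) module_scheme
      \<Rightarrow> ('n \<Rightarrow> 'm) \<Rightarrow> ('b \<times> 'n \<Rightarrow>\<^sub>0 int) set \<Rightarrow> ('b \<times> 'm \<Rightarrow>\<^sub>0 int) set" where
  "tensor_map R B M f C =
     (\<Union>x\<in>C. tensor_class R B M (frag_extend (\<lambda>(b, n). frag_of (b, f n)) x))"


section \<open>Module closures and test ideals\<close>

definition module_closure ::
    "('a, 'c) ring_scheme \<Rightarrow> ('a, 'b, 'd) module_scheme \<Rightarrow> ('a, 'm, 'e) module_scheme
      \<Rightarrow> 'm set \<Rightarrow> 'm set" where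
  "module_closure R B M N =
     {u \<in> carrier M. \<forall>b\<in>carrier B.
        pure_tensor R B M b u
          \<in> tensor_map R B M (\<lambda>n. n) ` carrier (tensor_product R B (M\<lparr>carrier := N\<rparr>))}"

definition module_colon ::
    "('a, 'c) ring_scheme \<Rightarrow> ('a, 'm, 'e) module_scheme \<Rightarrow> 'm set \<Rightarrow> 'm set \<Rightarrow> 'a set" where
  "module_colon R M N L = {r \<in> carrier R. \<forall>u\<in>L. r \<odot>\<^bsub>M\<^esub> u \<in> N}"

text \<open>HOL cannot quantify over all modules at once, so the test ideals range over the modules
  whose carrier is a set of elements of a type \<open>'m\<close>. Any \<open>'m\<close> into which \<open>'a + 'b + nat\<close>
  injects already gives the intersection over all modules. For, passing to quotients, \<open>r\<close> lies
  in the test ideal iff \<open>r\<close> annihilates every \<open>u \<in> M\<close> such that \<open>b \<otimes> u = 0\<close> in \<open>B \<otimes> M\<close> for all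
  \<open>b \<in> B\<close>. For each \<open>b\<close> the vanishing involves only finitely many elements of \<open>M\<close>, so \<open>M\<close> may be
  replaced by a submodule generated by at most \<open>|B| + \<aleph>\<^sub>0\<close> elements, whose cardinality is at most
  that of \<open>'a + 'b + nat\<close>. In the finitistic case \<open>M / N\<close> itself is that small.\<close>

definition test_ideal ::
    "'m itself \<Rightarrow> ('a, 'c) ring_scheme \<Rightarrow> ('a, 'b, 'd) module_scheme \<Rightarrow> 'a set" where
  "test_ideal (_ :: 'm itself) R B =
     \<Inter>{module_colon R M N (module_closure R B M N) | (M :: ('a, 'm) module) N.
          module R M \<and> submodule N R M}"

definition fg_test_ideal ::
    "'m itself \<Rightarrow> ('a, 'c) ring_scheme \<Rightarrow> ('a, 'b, 'd) module_scheme \<Rightarrow> 'a set" where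
  "fg_test_ideal (_ :: 'm itself) R B =
     \<Inter>{module_colon R M N (module_closure R B M N) | (M :: ('a, 'm) module) N.
          module R M \<and> submodule N R M \<and> fin_gen_module R (quotient_module M N)}"

end

theory Submission
  imports Defs
begin

text \<open>
  That a test ideal is the unit ideal says that the submodules it ranges over are closed. Only one
  kind of closed submodule matters here: an ideal \<open>I\<close> inside \<open>R\<close> itself, whose quotient is cyclic,
  so that the finitistic test ideal suffices. If \<open>a B \<subseteq> I B\<close>, then \<open>b \<otimes> a = a b \<otimes> 1\<close> lies in the
  image of \<open>B \<otimes> I\<close> for all \<open>b\<close>, so \<open>a\<close> lies in the closure of \<open>I\<close>, which is \<open>I\<close>
  (\<open>smult_in_module_closure\<close>, \<open>ideals_closed_if_test_ideal_trivial\<close>). Now let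
  \<open>x\<^sub>1, \<dots>, x\<^sub>d\<close> be a system of parameters and \<open>x\<^sub>i a \<in> I = (x\<^sub>1, \<dots>, x\<^bsub>i-1\<^esub>)\<close>. For each \<open>b\<close>, the element
  \<open>x\<^sub>i (a b)\<close> lies in \<open>I B\<close>, hence so does \<open>a b\<close>, since the parameters form a regular sequence on \<open>B\<close>.
  Thus \<open>a \<in> I\<close>: the system of parameters is a regular sequence on \<open>R\<close>, and the depth is at least
  the dimension.

  Two facts of dimension theory complete the argument. The depth never exceeds the dimension: a
  nonzerodivisor modulo \<open>I\<close> that lies in a prime \<open>P \<supseteq> I\<close> forces a smaller prime over \<open>I\<close>, so a
  regular sequence of length \<open>n\<close> yields a chain of \<open>n + 1\<close> primes
  (\<open>prime_chain_of_regular_sequence\<close>). And systems of parameters exist: they are built by prime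
  avoidance (\<open>elements_raising_height\<close>), once the dimension is known to be finite. Finiteness rests on
  Krull's principal ideal theorem: it allows a chain of primes to be pushed up so that all but its
  lowest member contain a given element of its top. Doing this for each of the generators of \<open>\<mm>\<close>,
  and dropping the lowest member each time, leaves only \<open>\<mm>\<close> itself
  (\<open>prime_chain_through_set\<close>, \<open>prime_chains_bounded\<close>).

  The dimension theory takes place inside \<open>R\<close>, without localisations or quotients. The ideals of
  \<open>R\<^sub>P\<close> correspond to the ideals of \<open>R\<close> that are saturated with respect to the complement of \<open>P\<close>, and
  an ideal of \<open>R / Q\<close> is an ideal of \<open>R\<close> containing \<open>Q\<close>.
\<close>

section \<open>Ideals of a commutative ring\<close>

lemma (in cring) ideal_by_closure:
  assumes "I \<subseteq> carrier R" "\<zero> \<in> I"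
    and "\<And>a b. a \<in> I \<Longrightarrow> b \<in> I \<Longrightarrow> a \<oplus> b \<in> I"
    and "\<And>r a. r \<in> carrier R \<Longrightarrow> a \<in> I \<Longrightarrow> r \<otimes> a \<in> I"
  shows "ideal I R"
proof (rule idealI)
  show "subgroup I (add_monoid R)"
  proof (rule add.subgroupI)
    fix a assume a: "a \<in> I"
    then have "\<ominus> a = (\<ominus> \<one>) \<otimes> a" using assms(1) by (auto simp: l_minus)
    then show "\<ominus> a \<in> I" using assms(4)[of "\<ominus> \<one>" a] a by simp
  qed (use assms in auto)
  show "a \<otimes> x \<in> I" if "a \<in> I" "x \<in> carrier R" for a x
    using assms(1) assms(4)[OF that(2,1)] that m_comm by (metis subsetD)
qed (use assms ring_axioms in auto)

context cring
begin

lemma ideal_subset: "ideal I R \<Longrightarrow> I \<subseteq> carrier R"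
  by (simp add: ideal.Icarr subsetI)

lemma ideal_zero: "ideal I R \<Longrightarrow> \<zero> \<in> I"
  by (simp add: additive_subgroup.zero_closed ideal.axioms(1))

lemma ideal_add: "ideal I R \<Longrightarrow> a \<in> I \<Longrightarrow> b \<in> I \<Longrightarrow> a \<oplus> b \<in> I"
  by (simp add: additive_subgroup.a_closed ideal.axioms(1))

lemma ideal_mult: "ideal I R \<Longrightarrow> r \<in> carrier R \<Longrightarrow> a \<in> I \<Longrightarrow> r \<otimes> a \<in> I"
  by (rule ideal.I_l_closed)

lemma ideal_diff:
  assumes "ideal I R" "a \<in> I" "b \<in> I"
  shows "a \<ominus> b \<in> I"
  using assms by (simp add: a_minus_def additive_subgroup.a_closed additive_subgroup.a_inv_closed ideal.axioms(1))

lemma ideal_add_cancel: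
  assumes "ideal I R" "a \<in> carrier R" "b \<in> I" "a \<oplus> b \<in> I"
  shows "a \<in> I"
proof -
  have "a = (a \<oplus> b) \<ominus> b"
    using assms(2) subsetD[OF ideal_subset[OF assms(1)] assms(3)] by algebra
  then show ?thesis using ideal_diff[OF assms(1,4,3)] by simp
qed

lemma primeideal_ideal: "primeideal P R \<Longrightarrow> ideal P R"
  by (simp add: primeideal.axioms(1))

lemma primeideal_one: "primeideal P R \<Longrightarrow> \<one> \<notin> P"
  by (metis ideal.one_imp_carrier primeideal.I_notcarr primeideal_ideal)

lemma primeideal_mult_notin:
  "primeideal P R \<Longrightarrow> a \<in> carrier R - P \<Longrightarrow> b \<in> carrier R - P \<Longrightarrow> a \<otimes> b \<in> carrier R - P"
  by (auto dest: primeideal.I_prime)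

lemma primeideal_pow_notin:
  "primeideal P R \<Longrightarrow> a \<in> carrier R - P \<Longrightarrow> a [^] (n::nat) \<in> carrier R - P"
  by (induction n) (use primeideal_one primeideal_mult_notin in auto)

text \<open>The ideal \<open>I + (a)\<close>, written out so that its members come with explicit coefficients.\<close>

definition adjoin :: "'a set \<Rightarrow> 'a \<Rightarrow> 'a set" where
  "adjoin I a = {i \<oplus> r \<otimes> a | i r. i \<in> I \<and> r \<in> carrier R}"

lemma adjoin_ideal:
  assumes "ideal I R" "a \<in> carrier R"
  shows "ideal (adjoin I a) R"
proof (rule ideal_by_closure)
  note I = ideal_subset[OF assms(1)] ideal_zero[OF assms(1)]
  show "adjoin I a \<subseteq> carrier R" using assms I by (auto simp: adjoin_def)
  show "\<zero> \<in> adjoin I a"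
    unfolding adjoin_def using I assms by (intro CollectI exI[of _ \<zero>]) auto
  show "x \<oplus> y \<in> adjoin I a" if "x \<in> adjoin I a" "y \<in> adjoin I a" for x y
  proof -
    from that obtain i r j s where *: "x = i \<oplus> r \<otimes> a" "y = j \<oplus> s \<otimes> a" "i \<in> I" "j \<in> I"
      "r \<in> carrier R" "s \<in> carrier R" by (auto simp: adjoin_def)
    have "i \<in> carrier R" "j \<in> carrier R" using * I by auto
    then have "x \<oplus> y = (i \<oplus> j) \<oplus> (r \<oplus> s) \<otimes> a" using * assms by algebra
    then show ?thesis unfolding adjoin_def using * ideal_add[OF assms(1)] by blast
  qed
  show "t \<otimes> x \<in> adjoin I a" if t: "t \<in> carrier R" and "x \<in> adjoin I a" for t x
  proof -
    from that obtain i r where *: "x = i \<oplus> r \<otimes> a" "i \<in> I" "r \<in> carrier R"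
      by (auto simp: adjoin_def)
    have "i \<in> carrier R" using * I by auto
    then have "t \<otimes> x = (t \<otimes> i) \<oplus> (t \<otimes> r) \<otimes> a" using * assms t by algebra
    then show ?thesis unfolding adjoin_def using * ideal_mult[OF assms(1)] t by blast
  qed
qed

lemma adjoin_superset:
  assumes "ideal I R" "a \<in> carrier R"
  shows "I \<subseteq> adjoin I a" "a \<in> adjoin I a"
proof -
  have "i = i \<oplus> \<zero> \<otimes> a" if "i \<in> I" for i
    using ideal_subset[OF assms(1)] assms that by auto
  then show "I \<subseteq> adjoin I a" unfolding adjoin_def using zero_closed by blast
  have "a = \<zero> \<oplus> \<one> \<otimes> a" using assms by simp
  then show "a \<in> adjoin I a" unfolding adjoin_def using ideal_zero[OF assms(1)] one_closed by blast
qed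

lemma adjoin_least:
  assumes "ideal J R" "I \<subseteq> J" "a \<in> J"
  shows "adjoin I a \<subseteq> J"
  using assms ideal_add ideal_mult unfolding adjoin_def by blast

lemma adjoin_mono: "I \<subseteq> J \<Longrightarrow> adjoin I a \<subseteq> adjoin J a"
  unfolding adjoin_def by blast

text \<open>The reason why an ideal that is maximal among those missing a multiplicative set is prime.\<close>

lemma adjoin_mult:
  assumes "ideal I R" "a \<in> carrier R" "b \<in> carrier R" "a \<otimes> b \<in> I"
    "x \<in> adjoin I a" "y \<in> adjoin I b"
  shows "x \<otimes> y \<in> I"
proof -
  from assms obtain i r j s where *: "x = i \<oplus> r \<otimes> a" "y = j \<oplus> s \<otimes> b" "i \<in> I" "j \<in> I"
    "r \<in> carrier R" "s \<in> carrier R" by (auto simp: adjoin_def)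
  have c: "i \<in> carrier R" "j \<in> carrier R" using * ideal_subset[OF assms(1)] by auto
  have "x \<otimes> y = (j \<oplus> s \<otimes> b) \<otimes> i \<oplus> ((r \<otimes> a) \<otimes> j \<oplus> (r \<otimes> s) \<otimes> (a \<otimes> b))"
    using * assms c by algebra
  moreover have "(j \<oplus> s \<otimes> b) \<otimes> i \<in> I" "(r \<otimes> a) \<otimes> j \<in> I" "(r \<otimes> s) \<otimes> (a \<otimes> b) \<in> I"
    using * assms c by (simp_all add: ideal_mult[OF assms(1)])
  ultimately show ?thesis using ideal_add[OF assms(1)] by simp
qed

definition colon_elt :: "'a set \<Rightarrow> 'a \<Rightarrow> 'a set" where
  "colon_elt I a = {r \<in> carrier R. r \<otimes> a \<in> I}"

lemma colon_elt_ideal: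
  assumes "ideal I R" "a \<in> carrier R"
  shows "ideal (colon_elt I a) R"
proof (rule ideal_by_closure)
  show "\<zero> \<in> colon_elt I a" using assms ideal_zero by (auto simp: colon_elt_def)
  show "x \<oplus> y \<in> colon_elt I a" if "x \<in> colon_elt I a" "y \<in> colon_elt I a" for x y
    using that assms ideal_add by (auto simp: colon_elt_def l_distr)
  show "t \<otimes> x \<in> colon_elt I a" if "t \<in> carrier R" "x \<in> colon_elt I a" for t x
    using that assms ideal_mult by (auto simp: colon_elt_def m_assoc)
qed (auto simp: colon_elt_def)

section \<open>Saturation at a prime\<close>

text \<open>For a prime \<open>P\<close> this is the preimage in \<open>R\<close> of the extension of \<open>I\<close> to the localisation \<open>R\<^sub>P\<close>.\<close>

definition saturation :: "'a set \<Rightarrow> 'a set \<Rightarrow> 'a set" where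
  "saturation P I = {a \<in> carrier R. \<exists>s\<in>carrier R - P. s \<otimes> a \<in> I}"

definition saturated :: "'a set \<Rightarrow> 'a set \<Rightarrow> bool" where
  "saturated P I \<longleftrightarrow> ideal I R \<and> (\<forall>a\<in>carrier R. \<forall>s\<in>carrier R - P. s \<otimes> a \<in> I \<longrightarrow> a \<in> I)"

lemma saturatedD:
  "saturated P I \<Longrightarrow> s \<in> carrier R - P \<Longrightarrow> a \<in> carrier R \<Longrightarrow> s \<otimes> a \<in> I \<Longrightarrow> a \<in> I"
  by (auto simp: saturated_def)

lemma saturated_ideal: "saturated P I \<Longrightarrow> ideal I R"
  by (simp add: saturated_def)

lemma saturation_superset:
  assumes "primeideal P R" "ideal I R"
  shows "I \<subseteq> saturation P I"
proof
  fix a assume "a \<in> I"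
  moreover have "\<one> \<in> carrier R - P" using primeideal_one[OF assms(1)] by simp
  ultimately show "a \<in> saturation P I"
    unfolding saturation_def using ideal_subset[OF assms(2)] by (auto intro!: bexI[of _ \<one>])
qed

lemma saturation_mono: "I \<subseteq> J \<Longrightarrow> saturation P I \<subseteq> saturation P J"
  unfolding saturation_def by blast

lemma saturation_saturated:
  assumes P: "primeideal P R" and I: "ideal I R"
  shows "saturated P (saturation P I)"
  unfolding saturated_def
proof (intro conjI ballI impI)
  show "ideal (saturation P I) R"
  proof (rule ideal_by_closure)
    show "\<zero> \<in> saturation P I" using saturation_superset[OF assms] ideal_zero[OF I] by blast
    show "x \<oplus> y \<in> saturation P I" if "x \<in> saturation P I" "y \<in> saturation P I" for x y
    proof -
      from that obtain s t where *: "s \<in> carrier R - P" "t \<in> carrier R - P" "s \<otimes> x \<in> I" "t \<otimes> y \<in> I"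
        "x \<in> carrier R" "y \<in> carrier R" by (auto simp: saturation_def)
      have "(s \<otimes> t) \<otimes> (x \<oplus> y) = t \<otimes> (s \<otimes> x) \<oplus> s \<otimes> (t \<otimes> y)" using * by (auto, algebra)
      moreover have "\<dots> \<in> I" using * ideal_mult[OF I] ideal_add[OF I] by auto
      ultimately have "(s \<otimes> t) \<otimes> (x \<oplus> y) \<in> I" by simp
      then show ?thesis
        using * primeideal_mult_notin[OF P *(1,2)] unfolding saturation_def by blast
    qed
    show "r \<otimes> x \<in> saturation P I" if "r \<in> carrier R" "x \<in> saturation P I" for r x
    proof -
      from that obtain s where *: "s \<in> carrier R - P" "s \<otimes> x \<in> I" "x \<in> carrier R"
        by (auto simp: saturation_def)
      have "s \<otimes> (r \<otimes> x) = r \<otimes> (s \<otimes> x)" using * that by (auto, algebra)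
      then have "s \<otimes> (r \<otimes> x) \<in> I" using * that(1) ideal_mult[OF I] by simp
      then show ?thesis using * that(1) unfolding saturation_def by blast
    qed
  qed (auto simp: saturation_def)
  fix a s assume a: "a \<in> carrier R" "s \<in> carrier R - P" "s \<otimes> a \<in> saturation P I"
  then obtain t where t: "t \<in> carrier R - P" "t \<otimes> (s \<otimes> a) \<in> I" by (auto simp: saturation_def)
  then have "(t \<otimes> s) \<otimes> a \<in> I" using a by (simp add: m_assoc)
  then show "a \<in> saturation P I"
    using a primeideal_mult_notin[OF P t(1) a(2)] unfolding saturation_def by auto
qed

lemma colon_elt_saturated:
  assumes "saturated P I" "a \<in> carrier R"
  shows "saturated P (colon_elt I a)"
  using assms colon_elt_ideal unfolding saturated_def colon_elt_def by (auto simp: m_assoc)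

lemma saturated_antimono: "saturated Q I \<Longrightarrow> Q \<subseteq> P \<Longrightarrow> saturated P I"
  unfolding saturated_def by blast

end

section \<open>Primes of Noetherian rings\<close>

locale noetherian_cring = noetherian_ring R + cring R for R (structure)
begin

text \<open>The ascending chain condition as an existence principle for maximal elements; the union of a
  nonempty chain of ideals with property \<open>T\<close> is a member of the chain, so Zorn applies.\<close>

lemma maximal_ideal_with:
  assumes "T I" and T: "\<And>J. T J \<Longrightarrow> ideal J R"
  obtains M where "T M" "\<And>J. T J \<Longrightarrow> M \<subseteq> J \<Longrightarrow> J = M"
proof -
  have "\<exists>M\<in>Collect T. \<forall>J\<in>Collect T. M \<subseteq> J \<longrightarrow> J = M"
  proof (rule subset_Zorn_nonempty)
    fix C assume C: "C \<noteq> {}" "subset.chain (Collect T) C"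
    have sub: "C \<subseteq> Collect T" using C(2) by (simp add: subset_chain_def)
    then have "C \<subseteq> {I. ideal I R}" using T by (simp add: subset_iff)
    then have "subset.chain {I. ideal I R} C"
      using C(2) by (simp add: subset_chain_def)
    then have "\<Union>C \<in> C" by (rule ideal_chain_is_trivial[OF C(1)])
    with sub show "\<Union>C \<in> Collect T" by (rule subsetD)
  qed (use assms(1) in blast)
  then show ?thesis using that by (metis mem_Collect_eq)
qed

lemma noetherian_induct [consumes 1, case_names step]:
  assumes "ideal I R"
    and step: "\<And>I. ideal I R \<Longrightarrow> (\<And>J. ideal J R \<Longrightarrow> I \<subset> J \<Longrightarrow> T J) \<Longrightarrow> T I"
  shows "T I"
proof (rule ccontr)
  assume "\<not> T I"
  then obtain M where M: "ideal M R \<and> \<not> T M"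
    and mx: "\<And>J. ideal J R \<and> \<not> T J \<Longrightarrow> M \<subseteq> J \<Longrightarrow> J = M"
    using maximal_ideal_with[of "\<lambda>J. ideal J R \<and> \<not> T J" I] assms(1) by metis
  have "T M"
  proof (rule step)
    show "T J" if "ideal J R" "M \<subset> J" for J
      using mx[of J] that by (metis order_less_le)
  qed (use M in simp)
  then show False using M by simp
qed

lemma not_prime_split:
  assumes "ideal I R" "I \<noteq> carrier R" "\<not> primeideal I R"
  obtains a b where "a \<in> carrier R" "b \<in> carrier R" "a \<notin> I" "b \<notin> I" "a \<otimes> b \<in> I"
  using primeidealI[OF assms(1) is_cring] assms(2,3) by metis

text \<open>An ideal maximal among those that contain \<open>I\<close> and miss \<open>S\<close> is prime: if \<open>a b\<close> lies in it and
  neither factor does, then adjoining \<open>a\<close> and \<open>b\<close> in turn gives two elements of \<open>S\<close> whose product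
  falls back into the ideal.\<close>

lemma prime_avoiding_mult_set:
  assumes I: "ideal I R" and disj: "I \<inter> S = {}" and S: "\<one> \<in> S"
    and mult: "\<And>a b. a \<in> S \<Longrightarrow> b \<in> S \<Longrightarrow> a \<otimes> b \<in> S"
  obtains Q where "primeideal Q R" "I \<subseteq> Q" "Q \<inter> S = {}"
proof -
  let ?T = "\<lambda>J. ideal J R \<and> I \<subseteq> J \<and> J \<inter> S = {}"
  have "?T I" using I disj by simp
  then obtain J where J: "ideal J R" "I \<subseteq> J" "J \<inter> S = {}"
    and mx: "\<And>K. ?T K \<Longrightarrow> J \<subseteq> K \<Longrightarrow> K = J"
    using maximal_ideal_with[of ?T I] by metis
  have meets: "\<exists>x\<in>S. x \<in> adjoin J a" if a: "a \<in> carrier R" "a \<notin> J" for a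
  proof (rule ccontr)
    assume "\<not> ?thesis"
    then have "adjoin J a \<inter> S = {}" by blast
    moreover note adjoin_ideal[OF J(1) a(1)] adjoin_superset[OF J(1) a(1)]
    ultimately show False using mx[of "adjoin J a"] J(2) a(2) order_trans[of I J "adjoin J a"] by simp
  qed
  have "primeideal J R"
  proof (rule ccontr)
    assume np: "\<not> ?thesis"
    have "J \<noteq> carrier R" using J(3) S one_closed by blast
    then obtain a b where ab: "a \<in> carrier R" "b \<in> carrier R" "a \<notin> J" "b \<notin> J" "a \<otimes> b \<in> J"
      using not_prime_split[OF J(1) _ np] by metis
    obtain x y where "x \<in> adjoin J a" "x \<in> S" "y \<in> adjoin J b" "y \<in> S"
      using meets[OF ab(1,3)] meets[OF ab(2,4)] by blast
    then have "x \<otimes> y \<in> J" "x \<otimes> y \<in> S" using adjoin_mult[OF J(1) ab(1,2,5)] mult by simp_all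
    then show False using J(3) by blast
  qed
  then show ?thesis using that J(2,3) by metis
qed

text \<open>The finiteness of the set of minimal primes over \<open>I\<close>, by Noetherian induction: if \<open>a b \<in> I\<close>, a
  prime over \<open>I\<close> contains \<open>I + (a)\<close> or \<open>I + (b)\<close>. Not insisting that the members of \<open>F\<close> be minimal
  lets the induction just take unions.\<close>

lemma finitely_many_primes_below:
  assumes "ideal I R"
  shows "\<exists>F. finite F \<and> (\<forall>Q\<in>F. primeideal Q R \<and> I \<subseteq> Q) \<and>
           (\<forall>P. primeideal P R \<longrightarrow> I \<subseteq> P \<longrightarrow> (\<exists>Q\<in>F. Q \<subseteq> P))"
  using assms
proof (induction I rule: noetherian_induct)
  case (step I)
  consider "primeideal I R" | "I = carrier R" | "I \<noteq> carrier R" "\<not> primeideal I R" by blast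
  then show ?case
  proof cases
    case 1
    then show ?thesis by (intro exI[of _ "{I}"]) auto
  next
    case 2
    then have "\<not> I \<subseteq> P" if "primeideal P R" for P
      using that primeideal_one by blast
    then show ?thesis by (intro exI[of _ "{}"]) auto
  next
    case 3
    then obtain a b where ab: "a \<in> carrier R" "b \<in> carrier R" "a \<notin> I" "b \<notin> I" "a \<otimes> b \<in> I"
      using not_prime_split[OF step.hyps] by blast
    have lt: "I \<subset> adjoin I a" "I \<subset> adjoin I b"
      using ab adjoin_superset[OF step.hyps ab(1)] adjoin_superset[OF step.hyps ab(2)] by blast+
    obtain F where
      F: "finite F" "\<And>Q. Q \<in> F \<Longrightarrow> primeideal Q R \<and> adjoin I a \<subseteq> Q"
        "\<And>P. primeideal P R \<Longrightarrow> adjoin I a \<subseteq> P \<Longrightarrow> \<exists>Q\<in>F. Q \<subseteq> P"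
      using step.IH[OF adjoin_ideal[OF step.hyps ab(1)] lt(1)] by metis
    obtain G where
      G: "finite G" "\<And>Q. Q \<in> G \<Longrightarrow> primeideal Q R \<and> adjoin I b \<subseteq> Q"
        "\<And>P. primeideal P R \<Longrightarrow> adjoin I b \<subseteq> P \<Longrightarrow> \<exists>Q\<in>G. Q \<subseteq> P"
      using step.IH[OF adjoin_ideal[OF step.hyps ab(2)] lt(2)] by metis
    have "\<exists>Q\<in>F \<union> G. Q \<subseteq> P" if P: "primeideal P R" "I \<subseteq> P" for P
    proof -
      have "a \<in> P \<or> b \<in> P"
        using P(2) ab(5) by (intro primeideal.I_prime[OF P(1) ab(1,2)]) blast
      then have "adjoin I a \<subseteq> P \<or> adjoin I b \<subseteq> P"
        using adjoin_least[OF primeideal_ideal[OF P(1)] P(2)] by metis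
      then show ?thesis using F(3)[OF P(1)] G(3)[OF P(1)] by blast
    qed
    moreover have "primeideal Q R \<and> I \<subseteq> Q" if "Q \<in> F \<union> G" for Q
      using that F(2)[of Q] G(2)[of Q] lt by blast
    ultimately show ?thesis using F(1) G(1) by (intro exI[of _ "F \<union> G"]) simp
  qed
qed

lemma minimal_prime_below:
  assumes "ideal I R" "primeideal P R" "I \<subseteq> P"
  obtains Q where "primeideal Q R" "I \<subseteq> Q" "Q \<subseteq> P"
    "\<And>Q'. primeideal Q' R \<Longrightarrow> I \<subseteq> Q' \<Longrightarrow> Q' \<subseteq> Q \<Longrightarrow> Q' = Q"
proof -
  obtain F where F: "finite F" "\<And>Q. Q \<in> F \<Longrightarrow> primeideal Q R \<and> I \<subseteq> Q"
    "\<And>P. primeideal P R \<Longrightarrow> I \<subseteq> P \<Longrightarrow> \<exists>Q\<in>F. Q \<subseteq> P"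
    using finitely_many_primes_below[OF assms(1)] by metis
  let ?G = "{Q\<in>F. Q \<subseteq> P}"
  have "finite ?G" "?G \<noteq> {}" using F(1) F(3)[OF assms(2,3)] by auto
  then obtain Q where Q: "Q \<in> ?G" "\<forall>Q'\<in>?G. Q' \<subseteq> Q \<longrightarrow> Q = Q'"
    using finite_has_minimal[of ?G] by metis
  show ?thesis
  proof (rule that[of Q])
    fix Q' assume Q': "primeideal Q' R" "I \<subseteq> Q'" "Q' \<subseteq> Q"
    then obtain Q'' where Q'': "Q'' \<in> F" "Q'' \<subseteq> Q'" using F(3) by metis
    then have "Q = Q''" using Q Q'(3) order_trans[OF Q''(2)] by blast
    then show "Q' = Q" using Q''(2) Q'(3) by simp
  qed (use F(2)[of Q] Q(1) in simp_all)
qed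

section \<open>Krull's principal ideal theorem\<close>

text \<open>If \<open>P\<close> is minimal over \<open>K\<close>, the local ring \<open>R\<^sub>P / K R\<^sub>P\<close> is Artinian; this is its descending
  chain condition. By Noetherian induction one may assume the claim for all larger ideals. If \<open>I\<close> is prime or \<open>R\<close>, then no saturated ideal over \<open>I\<close> other than \<open>P\<close> and \<open>R\<close> exists.
  Otherwise take \<open>a, b \<notin> I\<close> with \<open>a b \<in> I\<close>. The chains of the saturations of
  \<open>J n + (a)\<close> (over \<open>I + (a)\<close>) and \<open>J n : a\<close>
  (over \<open>I : a\<close>, which contains \<open>b\<close>) stabilise, and these two determine \<open>J n\<close> within a descending
  chain.\<close>

lemma saturated_dcc:
  fixes J :: "nat \<Rightarrow> 'a set"
  assumes P: "primeideal P R"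
    and min: "\<And>Q. primeideal Q R \<Longrightarrow> K \<subseteq> Q \<Longrightarrow> Q \<subseteq> P \<Longrightarrow> Q = P"
    and I: "ideal I R" "K \<subseteq> I"
    and J: "\<And>n. saturated P (J n)" "\<And>n. I \<subseteq> J n" "\<And>n. J (Suc n) \<subseteq> J n"
  shows "\<exists>n0. \<forall>n\<ge>n0. J (Suc n) = J n"
  using I J
proof (induction I arbitrary: J rule: noetherian_induct)
  case (step I)
  have Jid: "ideal (J n) R" for n using step.prems saturated_ideal by blast
  show ?case
  proof (cases "primeideal I R \<or> I = carrier R")
    case pI: True
    have "J n = carrier R \<or> J n = P" for n
    proof (cases "J n \<subseteq> P")
      case True
      then have IP: "I \<subseteq> P" using step.prems(3)[of n] by (rule order_trans[rotated])
      then have "primeideal I R"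
        using pI primeideal_one[OF P] one_closed by (metis subsetD)
      then have "I = P" using min[OF _ step.prems(1) IP] by simp
      then show ?thesis using True step.prems(3)[of n] by simp
    next
      case False
      then obtain s where s: "s \<in> J n" "s \<in> carrier R - P" using ideal_subset[OF Jid] by blast
      then have "\<one> \<in> J n" using saturatedD[OF step.prems(2), of s \<one>] by simp
      then show ?thesis using ideal.one_imp_carrier[OF Jid] by blast
    qed note alt = this
    show ?thesis
    proof (cases "\<exists>n. J n \<noteq> carrier R")
      case True
      then obtain n0 where n0: "J n0 \<noteq> carrier R" by blast
      have "J n = P" if "n \<ge> n0" for n
        using that
      proof (induction n rule: dec_induct)
        case base
        show ?case using alt n0 by blast
      next
        case (step n)
        have "\<one> \<notin> J (Suc n)" using step.IH \<open>J (Suc n) \<subseteq> J n\<close> primeideal_one[OF P] by blast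
        then show ?case using alt[of "Suc n"] by auto
      qed
      then show ?thesis by (metis le_SucI)
    next
      case False
      then show ?thesis by simp
    qed
  next
    case False
    then obtain a b where ab: "a \<in> carrier R" "b \<in> carrier R" "a \<notin> I" "b \<notin> I" "a \<otimes> b \<in> I"
      using not_prime_split[OF step.hyps] by blast
    define A where "A n = saturation P (adjoin (J n) a)" for n
    define C where "C n = colon_elt (J n) a" for n
    have "\<exists>n0. \<forall>n\<ge>n0. A (Suc n) = A n"
    proof (rule step.IH[of "adjoin I a"])
      show "ideal (adjoin I a) R" using adjoin_ideal step.hyps ab by blast
      show "I \<subset> adjoin I a" using adjoin_superset[OF step.hyps] ab by blast
      then show "K \<subseteq> adjoin I a" using step.prems by blast
      show "saturated P (A n)" for n
        unfolding A_def using saturation_saturated[OF P] adjoin_ideal[OF Jid] ab by blast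
      show "adjoin I a \<subseteq> A n" for n
        unfolding A_def using saturation_superset[OF P adjoin_ideal[OF Jid ab(1)]] adjoin_mono step.prems(3)
        by blast
      show "A (Suc n) \<subseteq> A n" for n
        unfolding A_def by (intro saturation_mono adjoin_mono step.prems)
    qed
    then obtain n1 where n1: "\<And>n. n \<ge> n1 \<Longrightarrow> A (Suc n) = A n" by blast
    have "\<exists>n0. \<forall>n\<ge>n0. C (Suc n) = C n"
    proof (rule step.IH[of "colon_elt I a"])
      show "ideal (colon_elt I a) R" using colon_elt_ideal step.hyps ab by blast
      have "I \<subseteq> colon_elt I a"
        using ideal_subset[OF step.hyps] ideal.I_r_closed[OF step.hyps _ ab(1)]
        by (auto simp: colon_elt_def)
      moreover have "b \<in> colon_elt I a" using ab by (simp add: colon_elt_def m_comm)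
      ultimately show "I \<subset> colon_elt I a" using ab by blast
      then show "K \<subseteq> colon_elt I a" using step.prems by blast
      show "saturated P (C n)" for n
        unfolding C_def using colon_elt_saturated step.prems ab by blast
      show "colon_elt I a \<subseteq> C n" "C (Suc n) \<subseteq> C n" for n
        unfolding C_def colon_elt_def using step.prems by blast+
    qed
    then obtain n2 where n2: "\<And>n. n \<ge> n2 \<Longrightarrow> C (Suc n) = C n" by blast
    \<comment> \<open>Some \<open>s u = v + r a\<close> with \<open>v \<in> J (n + 1)\<close>; then \<open>r \<in> J n : a = J (n + 1) : a\<close>.\<close>
    have "J n \<subseteq> J (Suc n)" if n: "n \<ge> max n1 n2" for n
    proof
      fix u assume u: "u \<in> J n"
      then have uc: "u \<in> carrier R" using ideal_subset[OF Jid] by blast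
      have "u \<in> A n"
        unfolding A_def using u saturation_superset[OF P adjoin_ideal[OF Jid ab(1)]]
          adjoin_superset(1)[OF Jid ab(1)] by blast
      then have "u \<in> A (Suc n)" using n1 n by simp
      then obtain s v r where *: "s \<in> carrier R - P" "s \<otimes> u = v \<oplus> r \<otimes> a" "v \<in> J (Suc n)" "r \<in> carrier R"
        unfolding A_def saturation_def adjoin_def by blast
      have vc: "v \<in> carrier R" "v \<in> J n" using * step.prems ideal_subset[OF Jid] by blast+
      have "r \<otimes> a = s \<otimes> u \<ominus> v" unfolding *(2) using * vc ab by algebra
      moreover have "s \<otimes> u \<ominus> v \<in> J n"
        using ideal_diff[OF Jid ideal_mult[OF Jid _ u] vc(2)] *(1) by blast
      ultimately have "r \<otimes> a \<in> J n" by (simp only:)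
      then have "r \<in> C n" unfolding C_def colon_elt_def using * by simp
      then have "r \<in> C (Suc n)" using n2 n by simp
      then have "r \<otimes> a \<in> J (Suc n)" unfolding C_def colon_elt_def by simp
      then have "s \<otimes> u \<in> J (Suc n)" using * ideal_add[OF Jid] by simp
      then show "u \<in> J (Suc n)" using saturatedD[OF step.prems(2) *(1) uc] by blast
    qed
    then show ?thesis using step.prems by blast
  qed
qed

text \<open>Nakayama's lemma for \<open>A / C\<close> over \<open>R\<^sub>P\<close>, where \<open>A = C + x A\<close>. Take
  \<open>D\<close> maximal among the saturated ideals with \<open>C \<subseteq> D \<subset> A\<close>. Then \<open>A / D\<close> is cyclic over \<open>R\<^sub>P\<close>,
  generated by some \<open>a\<close>, and \<open>A = C + x A\<close> makes a unit multiple of \<open>a\<close> vanish modulo \<open>D\<close>.\<close>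

lemma saturated_nakayama:
  assumes P: "primeideal P R" "x \<in> P"
    and A: "saturated P A" and C: "saturated P C" "C \<subseteq> A"
    and gen: "\<And>u. u \<in> A \<Longrightarrow> \<exists>s\<in>carrier R - P. \<exists>c\<in>C. \<exists>a\<in>A. s \<otimes> u = c \<oplus> x \<otimes> a"
  shows "A = C"
proof (rule ccontr)
  assume "A \<noteq> C"
  let ?T = "\<lambda>D. saturated P D \<and> C \<subseteq> D \<and> D \<subset> A"
  have "?T C" using C \<open>A \<noteq> C\<close> by blast
  then obtain D where D: "saturated P D" "C \<subseteq> D" "D \<subset> A"
    and mx: "\<And>K. ?T K \<Longrightarrow> D \<subseteq> K \<Longrightarrow> K = D"
    using maximal_ideal_with[of ?T C] saturated_ideal by metis
  have Did: "ideal D R" using saturated_ideal[OF D(1)] .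
  obtain a where a: "a \<in> A" "a \<notin> D" using D(3) by blast
  have Ac: "A \<subseteq> carrier R" using ideal_subset[OF saturated_ideal[OF A]] .
  have ac: "a \<in> carrier R" using a Ac by blast
  let ?E = "saturation P (adjoin D a)"
  have DE: "D \<subseteq> ?E" "a \<in> ?E"
    using saturation_superset[OF P(1) adjoin_ideal[OF Did ac]] adjoin_superset[OF Did ac] by blast+
  have EA: "?E \<subseteq> A"
  proof
    fix y assume "y \<in> ?E"
    then obtain s where "y \<in> carrier R" "s \<in> carrier R - P" "s \<otimes> y \<in> adjoin D a"
      unfolding saturation_def by blast
    moreover have "adjoin D a \<subseteq> A" using adjoin_least[OF saturated_ideal[OF A]] D(3) a(1) by blast
    ultimately show "y \<in> A" using saturatedD[OF A] by blast
  qed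
  have E: "?E = A"
  proof (rule ccontr)
    assume "?E \<noteq> A"
    moreover have "saturated P ?E" using saturation_saturated[OF P(1) adjoin_ideal[OF Did ac]] .
    ultimately have "?E = D" using EA DE(1) D(2) by (intro mx) auto
    then show False using DE(2) a(2) by simp
  qed
  obtain s c a' where s: "s \<in> carrier R - P" "c \<in> C" "a' \<in> A" "s \<otimes> a = c \<oplus> x \<otimes> a'"
    using gen[OF a(1)] by blast
  obtain t d r where t: "t \<in> carrier R - P" "t \<otimes> a' = d \<oplus> r \<otimes> a" "d \<in> D" "r \<in> carrier R"
    using s(3) unfolding E[symmetric] saturation_def adjoin_def by blast
  have Pid: "ideal P R" using primeideal_ideal[OF P(1)] .
  have cc: "c \<in> carrier R" "d \<in> carrier R" "a' \<in> carrier R" "x \<in> carrier R" "c \<in> D"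
    using s(2,3) t(3) P(2) D(2) Ac ideal_subset[OF Did] ideal_subset[OF Pid] by auto
  have sc: "s \<in> carrier R" "t \<in> carrier R" using s t by auto
  have "(t \<otimes> s) \<otimes> a = t \<otimes> (s \<otimes> a)" using ac sc by algebra
  also have "\<dots> = t \<otimes> c \<oplus> x \<otimes> (t \<otimes> a')" unfolding s(4) using ac sc cc by algebra
  also have "\<dots> = t \<otimes> c \<oplus> x \<otimes> (d \<oplus> r \<otimes> a)" unfolding t(2) ..
  finally have "(t \<otimes> s \<ominus> r \<otimes> x) \<otimes> a = t \<otimes> c \<oplus> x \<otimes> d" using ac sc cc t(4) by algebra
  then have "(t \<otimes> s \<ominus> r \<otimes> x) \<otimes> a \<in> D"
    using ideal_add[OF Did] ideal_mult[OF Did] sc cc t(3) by simp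
  \<comment> \<open>In \<open>R\<^sub>P\<close>, a unit minus an element of the maximal ideal.\<close>
  moreover have "t \<otimes> s \<ominus> r \<otimes> x \<in> carrier R - P"
  proof -
    have "t \<otimes> s \<notin> P" using primeideal_mult_notin[OF P(1) t(1) s(1)] by blast
    moreover have "t \<otimes> s = (t \<otimes> s \<ominus> r \<otimes> x) \<oplus> r \<otimes> x" using sc cc t(4) by algebra
    moreover have "r \<otimes> x \<in> P" using ideal_mult[OF Pid t(4) P(2)] .
    ultimately show ?thesis using ideal_add[OF Pid] sc cc t(4) by (metis DiffI m_closed minus_closed)
  qed
  ultimately show False using saturatedD[OF D(1) _ ac] a(2) by blast
qed

text \<open>Krull's principal ideal theorem in the domain \<open>R / Q0\<close>: a prime minimal over a principal ideal has
  height at most one. The part of the symbolic powers of \<open>Q\<close> is played by the saturations at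
  \<open>Q\<close> of the powers of a single element \<open>y \<in> Q - Q0\<close>. Modulo \<open>x\<close> they stabilise by the descending chain
  condition, and since \<open>x\<close> is a nonzerodivisor modulo a \<open>Q\<close>-saturated ideal, Nakayama's lemma removes
  \<open>x\<close>. Hence \<open>s y^n \<in> Q0 + (y^(n+1))\<close> with \<open>s \<notin> Q\<close>, and cancelling \<open>y^n\<close> modulo the prime \<open>Q0\<close> gives
  \<open>s \<in> Q\<close>.\<close>

lemma krull_principal_ideal:
  assumes Q0: "primeideal Q0 R" and Q: "primeideal Q R" and P: "primeideal P R"
    and lt: "Q0 \<subset> Q" "Q \<subset> P" and x: "x \<in> P"
    and min: "\<And>Q'. primeideal Q' R \<Longrightarrow> insert x Q0 \<subseteq> Q' \<Longrightarrow> Q' \<subseteq> P \<Longrightarrow> Q' = P"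
  shows False
proof -
  note Q0id = primeideal_ideal[OF Q0] and Qid = primeideal_ideal[OF Q] and Pid = primeideal_ideal[OF P]
  have xc: "x \<in> carrier R" using x ideal_subset[OF Pid] by blast
  have xQ: "x \<notin> Q" using min[OF Q] lt by blast
  obtain y where y: "y \<in> Q" "y \<notin> Q0" using lt by blast
  have yc: "y \<in> carrier R" using y ideal_subset[OF Qid] by blast
  have ync: "y [^] n \<in> carrier R" for n :: nat using yc by simp
  define A where "A n = saturation Q (adjoin Q0 (y [^] (n::nat)))" for n
  have Aid0: "ideal (adjoin Q0 (y [^] (n::nat))) R" for n using adjoin_ideal[OF Q0id] yc by simp
  have Asat: "saturated Q (A n)" for n
    unfolding A_def using saturation_saturated[OF Q Aid0] .
  then have AsatP: "saturated P (A n)" for n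
    using saturated_antimono[OF Asat] lt(2) by blast
  note Aid = saturated_ideal[OF Asat]
  have A0: "adjoin Q0 (y [^] n) \<subseteq> A n" for n
    unfolding A_def by (rule saturation_superset[OF Q Aid0])
  have Q0A: "Q0 \<subseteq> A n" for n using A0[of n] adjoin_superset(1)[OF Q0id ync, of n] by blast
  have yA: "y [^] n \<in> A n" for n using A0[of n] adjoin_superset(2)[OF Q0id ync, of n] by blast
  have Adec: "A (Suc n) \<subseteq> A n" for n
    unfolding A_def
  proof (intro saturation_mono adjoin_least[OF Aid0])
    show "Q0 \<subseteq> adjoin Q0 (y [^] n)" using adjoin_superset(1)[OF Q0id ync] .
    show "y [^] Suc n \<in> adjoin Q0 (y [^] n)"
      using ideal.I_r_closed[OF Aid0 adjoin_superset(2)[OF Q0id ync] yc] by simp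
  qed
  \<comment> \<open>The chain of the \<open>A n\<close> modulo \<open>x\<close>, to which the descending chain condition applies.\<close>
  define J where "J n = saturation P (adjoin (A n) x)" for n
  have AJid: "ideal (adjoin (A n) x) R" for n using adjoin_ideal[OF Aid xc] .
  have "\<exists>n0. \<forall>n\<ge>n0. J (Suc n) = J n"
  proof (rule saturated_dcc[OF P min adjoin_ideal[OF Q0id xc]])
    show "insert x Q0 \<subseteq> adjoin Q0 x" using adjoin_superset[OF Q0id xc] by blast
    show "saturated P (J n)" for n unfolding J_def using saturation_saturated[OF P AJid] .
    show "adjoin Q0 x \<subseteq> J n" for n
      unfolding J_def using saturation_superset[OF P AJid, of n] adjoin_mono[OF Q0A, of x n] by blast
    show "J (Suc n) \<subseteq> J n" for n
      unfolding J_def by (intro saturation_mono adjoin_mono Adec)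
  qed
  then obtain n where n: "J (Suc n) = J n" by blast
  have "A n = A (Suc n)"
  proof (rule saturated_nakayama[OF P x AsatP AsatP Adec])
    fix u assume u: "u \<in> A n"
    then have uc: "u \<in> carrier R" using ideal_subset[OF Aid] by blast
    have "u \<in> J n" unfolding J_def
      using u saturation_superset[OF P AJid[of n]] adjoin_superset(1)[OF Aid[of n] xc] by blast
    then have "u \<in> saturation P (adjoin (A (Suc n)) x)" using n J_def[of "Suc n"] by simp
    then obtain s where "s \<in> carrier R - P" "s \<otimes> u \<in> adjoin (A (Suc n)) x"
      unfolding saturation_def by blast
    then obtain v r where *: "s \<in> carrier R - P" "s \<otimes> u = v \<oplus> r \<otimes> x" "v \<in> A (Suc n)" "r \<in> carrier R"
      unfolding adjoin_def by blast
    have vc: "v \<in> A n" using *(3) Adec[of n] by blast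
    then have vc: "v \<in> carrier R" "v \<in> A n" using ideal_subset[OF Aid[of n]] by auto
    have "x \<otimes> r = s \<otimes> u \<ominus> v" unfolding *(2) using * vc xc by algebra
    moreover have "s \<otimes> u \<ominus> v \<in> A n"
      using ideal_diff[OF Aid ideal_mult[OF Aid _ u] vc(2)] *(1) by blast
    ultimately have "x \<otimes> r \<in> A n" by (simp only:)
    then have "r \<in> A n" using saturatedD[OF Asat[of n], of x r] xQ xc *(4) by blast
    moreover have "s \<otimes> u = v \<oplus> x \<otimes> r" using * xc by (simp add: m_comm)
    ultimately show "\<exists>s\<in>carrier R - P. \<exists>c\<in>A (Suc n). \<exists>a\<in>A n. s \<otimes> u = c \<oplus> x \<otimes> a"
      using *(1,3) by blast
  qed
  then have "y [^] n \<in> A (Suc n)" using yA[of n] by (simp only:)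
  then obtain s where "s \<in> carrier R - Q" "s \<otimes> y [^] n \<in> adjoin Q0 (y [^] Suc n)"
    unfolding A_def saturation_def by blast
  then obtain q r where *: "s \<in> carrier R - Q" "s \<otimes> y [^] n = q \<oplus> r \<otimes> y [^] Suc n" "q \<in> Q0" "r \<in> carrier R"
    unfolding adjoin_def by blast
  have qc: "q \<in> carrier R" using * ideal_subset[OF Q0id] by blast
  have sc: "s \<in> carrier R" using * by simp
  note pc = ync[of n]
  have "(s \<ominus> r \<otimes> y) \<otimes> y [^] n = s \<otimes> y [^] n \<ominus> r \<otimes> (y [^] n \<otimes> y)"
    using sc pc yc *(4) by algebra
  also have "\<dots> = (q \<oplus> r \<otimes> (y [^] n \<otimes> y)) \<ominus> r \<otimes> (y [^] n \<otimes> y)"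
    using *(2) by simp
  also have "\<dots> = q" using qc pc yc *(4) by algebra
  finally have "(s \<ominus> r \<otimes> y) \<otimes> y [^] n \<in> Q0" using *(3) by (simp only:)
  moreover have "y [^] n \<notin> Q0" using primeideal_pow_notin[OF Q0, of y n] y yc by simp
  ultimately have "s \<ominus> r \<otimes> y \<in> Q0"
    using primeideal.I_prime[OF Q0 _ pc, of "s \<ominus> r \<otimes> y"] sc yc *(4) by blast
  then have "s \<ominus> r \<otimes> y \<in> Q" using lt by blast
  then have "(s \<ominus> r \<otimes> y) \<oplus> r \<otimes> y \<in> Q"
    using ideal_add[OF Qid _ ideal_mult[OF Qid *(4) y(1)]] by blast
  moreover have "(s \<ominus> r \<otimes> y) \<oplus> r \<otimes> y = s" using sc yc *(4) by algebra
  ultimately have "s \<in> Q" by (simp only:)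
  then show False using * by blast
qed


section \<open>Chains of primes\<close>

text \<open>Strict chains \<open>Q = P\<^sub>0 \<subset> \<dots> \<subset> P\<^sub>n = T\<close>. The recursion peels off the bottom, because the
  inductions on chains keep the top fixed and vary the bottom.\<close>

primrec prime_chain :: "nat \<Rightarrow> 'a set \<Rightarrow> 'a set \<Rightarrow> bool" where
  "prime_chain 0 Q T \<longleftrightarrow> primeideal Q R \<and> T = Q"
| "prime_chain (Suc n) Q T \<longleftrightarrow> primeideal Q R \<and> (\<exists>Q'. Q \<subset> Q' \<and> prime_chain n Q' T)"

lemma prime_chain_primes:
  "prime_chain n Q T \<Longrightarrow> primeideal Q R \<and> primeideal T R \<and> Q \<subseteq> T"
proof (induction n arbitrary: Q)
  case (Suc n)
  then obtain Q' where "primeideal Q R" "Q \<subset> Q'" "prime_chain n Q' T" by auto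
  then show ?case using Suc.IH[of Q'] by auto
qed simp

lemma prime_chain_Suc_psubset: "prime_chain (Suc n) Q T \<Longrightarrow> Q \<subset> T"
  using prime_chain_primes[of n _ T] by auto

lemma prime_chain_snoc:
  "prime_chain n Q T \<Longrightarrow> primeideal T' R \<Longrightarrow> T \<subset> T' \<Longrightarrow> prime_chain (Suc n) Q T'"
  by (induction n arbitrary: Q) auto

lemma prime_chain_drop:
  "prime_chain (k + n) Q T \<Longrightarrow> \<exists>Q'. prime_chain n Q' T"
  by (induction k arbitrary: Q) auto

lemma prime_chain_iff_sequence:
  "(\<exists>Q T. prime_chain n Q T) \<longleftrightarrow>
     (\<exists>P. (\<forall>i\<le>n. primeideal (P i) R) \<and> (\<forall>i<n. P i \<subset> P (Suc i)))"
proof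
  have "\<exists>P. P 0 = Q \<and> (\<forall>i\<le>n. primeideal (P i) R) \<and> (\<forall>i<n. P i \<subset> P (Suc i))"
    if "prime_chain n Q T" for Q T
    using that
  proof (induction n arbitrary: Q)
    case 0
    then show ?case by (intro exI[of _ "\<lambda>_. Q"]) simp
  next
    case (Suc n)
    then obtain Q' P where *: "primeideal Q R" "Q \<subset> Q'" "P 0 = Q'"
      "\<forall>i\<le>n. primeideal (P i) R" "\<forall>i<n. P i \<subset> P (Suc i)" by (metis prime_chain.simps(2))
    then show ?case
      by (intro exI[of _ "case_nat Q P"]) (auto split: nat.split)
  qed
  then show "\<exists>P. (\<forall>i\<le>n. primeideal (P i) R) \<and> (\<forall>i<n. P i \<subset> P (Suc i))"
    if "\<exists>Q T. prime_chain n Q T" using that by metis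
next
  have "prime_chain n (P 0) (P n)"
    if "\<forall>i\<le>n. primeideal (P i) R" "\<forall>i<n. P i \<subset> P (Suc i)" for P
    using that by (induction n) (auto simp del: prime_chain.simps(2) intro!: prime_chain_snoc)
  then show "\<exists>Q T. prime_chain n Q T"
    if "\<exists>P. (\<forall>i\<le>n. primeideal (P i) R) \<and> (\<forall>i<n. P i \<subset> P (Suc i))" using that by metis
qed

text \<open>A prime minimal over \<open>Q0 + (x)\<close> inside \<open>Q2\<close> serves; it differs from \<open>Q2\<close> by the principal ideal
  theorem, since \<open>Q1\<close> lies strictly between \<open>Q0\<close> and \<open>Q2\<close>.\<close>

lemma prime_between_containing:
  assumes Q: "primeideal Q0 R" "primeideal Q1 R" "primeideal Q2 R"
    and lt: "Q0 \<subset> Q1" "Q1 \<subset> Q2" and x: "x \<in> Q2"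
  obtains Q where "primeideal Q R" "Q0 \<subset> Q" "Q \<subset> Q2" "x \<in> Q"
proof (cases "x \<in> Q0")
  case True
  then show ?thesis using that[of Q1] Q lt by blast
next
  case False
  note Q0id = primeideal_ideal[OF Q(1)] and Q2id = primeideal_ideal[OF Q(3)]
  have xc: "x \<in> carrier R" using ideal_subset[OF Q2id] x by blast
  note sup = adjoin_superset[OF Q0id xc]
  have "adjoin Q0 x \<subseteq> Q2" using adjoin_least[OF Q2id _ x] lt by blast
  then obtain P where P: "primeideal P R" "adjoin Q0 x \<subseteq> P" "P \<subseteq> Q2"
    "\<And>Q'. primeideal Q' R \<Longrightarrow> adjoin Q0 x \<subseteq> Q' \<Longrightarrow> Q' \<subseteq> P \<Longrightarrow> Q' = P"
    using minimal_prime_below[OF adjoin_ideal[OF Q0id xc] Q(3)] by metis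
  have "P \<noteq> Q2"
  proof
    assume "P = Q2"
    show False
    proof (rule krull_principal_ideal[OF Q lt x])
      fix Q' assume "primeideal Q' R" "insert x Q0 \<subseteq> Q'" "Q' \<subseteq> Q2"
      then show "Q' = Q2"
        using P(4)[of Q'] adjoin_least[of Q' Q0 x] primeideal_ideal[of Q'] \<open>P = Q2\<close> by simp
    qed
  qed
  then show ?thesis using that[of P] P(1-3) sup False by blast
qed

text \<open>From the top downwards, each prime strictly between \<open>Q\<close> and \<open>T\<close> is exchanged for one that
  contains \<open>x\<close>; the bottom \<open>Q\<close>, which cannot be exchanged, is then dropped.\<close>

lemma prime_chain_through_element:
  "prime_chain (Suc n) Q T \<Longrightarrow> x \<in> T \<Longrightarrow> \<exists>Q'. Q \<subset> Q' \<and> x \<in> Q' \<and> prime_chain n Q' T"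
proof (induction n arbitrary: Q)
  case 0
  then show ?case by auto
next
  case (Suc n)
  then obtain Q1 where Q1: "primeideal Q R" "Q \<subset> Q1" "prime_chain (Suc n) Q1 T"
    by (metis prime_chain.simps(2))
  then obtain Q2 where Q2: "Q1 \<subset> Q2" "x \<in> Q2" "prime_chain n Q2 T"
    using Suc by metis
  obtain Q' where "primeideal Q' R" "Q \<subset> Q'" "Q' \<subset> Q2" "x \<in> Q'"
    using prime_between_containing[of Q Q1 Q2 x] Q1 Q2 prime_chain_primes by metis
  moreover have "Q' \<subset> Q2 \<and> prime_chain n Q2 T" using calculation(3) Q2(3) by simp
  ultimately show ?case unfolding prime_chain.simps(2) by blast
qed

text \<open>One step of the chain is lost for each element of \<open>S\<close>. With \<open>S\<close> generating \<open>T\<close> this bounds the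
  height of \<open>T\<close> by the number of its generators.\<close>

lemma prime_chain_through_set:
  assumes "finite S" "S \<subseteq> T" "prime_chain (card S + k) Q T"
  shows "\<exists>Q'. Q \<subseteq> Q' \<and> S \<subseteq> Q' \<and> prime_chain k Q' T"
  using assms
proof (induction S arbitrary: Q)
  case empty
  then show ?case by auto
next
  case (insert x S)
  then have "prime_chain (Suc (card S + k)) Q T" "x \<in> T" by auto
  then obtain Q1 where Q1: "Q \<subset> Q1" "x \<in> Q1" "prime_chain (card S + k) Q1 T"
    using prime_chain_through_element by metis
  then obtain Q2 where "Q1 \<subseteq> Q2" "S \<subseteq> Q2" "prime_chain k Q2 T"
    using insert.IH[OF _ Q1(3)] insert.prems(1) by auto
  then show ?case using Q1 by (intro exI[of _ Q2]) auto
qed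

section \<open>Prime avoidance and nonzerodivisors\<close>

text \<open>A product of elements outside the prime \<open>Q\<close>, one from \<open>I\<close> and one from each member of \<open>G\<close>, does it.\<close>

lemma prime_avoiding_intersection:
  assumes Q: "primeideal Q R" and I: "ideal I R" "\<not> I \<subseteq> Q"
    and G: "finite G" "\<And>P. P \<in> G \<Longrightarrow> ideal P R \<and> \<not> P \<subseteq> Q"
  shows "\<exists>y\<in>I. y \<notin> Q \<and> (\<forall>P\<in>G. y \<in> P)"
  using G
proof (induction G)
  case empty
  then show ?case using I by auto
next
  case (insert P G)
  have "\<exists>y\<in>I. y \<notin> Q \<and> (\<forall>P\<in>G. y \<in> P)" using insert.prems by (intro insert.IH) simp
  then obtain y where y: "y \<in> I" "y \<notin> Q" "\<forall>P\<in>G. y \<in> P" by blast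
  have P: "ideal P R" "\<not> P \<subseteq> Q" using insert.prems[of P] by auto
  then obtain z where z: "z \<in> P" "z \<notin> Q" by blast
  have c: "y \<in> carrier R" "z \<in> carrier R"
    using y z ideal_subset[OF I(1)] ideal_subset[OF P(1)] by auto
  have "y \<otimes> z \<notin> Q" using primeideal.I_prime[OF Q c] y z by blast
  moreover have "y \<otimes> z \<in> I" using ideal.I_r_closed[OF I(1) y(1) c(2)] .
  moreover have "y \<otimes> z \<in> P" using ideal_mult[OF P(1) c(1) z(1)] .
  moreover have "y \<otimes> z \<in> P'" if "P' \<in> G" for P'
    using insert.prems[of P'] that y(3) ideal.I_r_closed[of P' R y z] c(2) by simp
  ultimately show ?case by (intro bexI[of _ "y \<otimes> z"]) auto
qed

text \<open>Induction on \<open>G\<close>. A member contained in another one can be dropped. Otherwise pick any \<open>Q\<close> in \<open>G\<close>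
  and \<open>x \<in> I\<close> avoiding the rest; should \<open>x\<close> lie in \<open>Q\<close>, correct it by an element of \<open>I\<close> that lies
  in all other members but not in \<open>Q\<close>.\<close>

lemma prime_avoidance:
  assumes "finite G" and I: "ideal I R"
    and "\<And>P. P \<in> G \<Longrightarrow> primeideal P R \<and> \<not> I \<subseteq> P"
  shows "\<exists>x\<in>I. \<forall>P\<in>G. x \<notin> P"
  using assms(1,3)
proof (induction G rule: finite_psubset_induct)
  case (psubset G)
  have smaller: "\<exists>x\<in>I. \<forall>P\<in>G - {Q}. x \<notin> P" if "Q \<in> G" for Q
    by (rule psubset.IH) (use that psubset.prems in auto)
  consider "G = {}" | Q Q' where "Q \<in> G" "Q' \<in> G" "Q \<subset> Q'"
    | Q where "Q \<in> G" "\<And>Q'. Q' \<in> G \<Longrightarrow> \<not> Q' \<subset> Q" by blast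
  then show ?case
  proof cases
    case 1
    then show ?thesis using ideal_zero[OF I] by auto
  next
    case 2
    then show ?thesis using smaller[of Q] by blast
  next
    case 3
    obtain x where x: "x \<in> I" "\<And>P. P \<in> G - {Q} \<Longrightarrow> x \<notin> P" using smaller[OF 3(1)] by blast
    show ?thesis
    proof (cases "x \<in> Q")
      case False
      then show ?thesis using x by blast
    next
      case True
      have Q: "primeideal Q R" "\<not> I \<subseteq> Q" using psubset.prems 3(1) by auto
      have "\<exists>y\<in>I. y \<notin> Q \<and> (\<forall>P\<in>G - {Q}. y \<in> P)"
      proof (rule prime_avoiding_intersection[OF Q(1) I Q(2)])
        fix P assume P: "P \<in> G - {Q}"
        then show "ideal P R \<and> \<not> P \<subseteq> Q"
          using psubset.prems[of P] primeideal_ideal[of P] 3(2)[of P] by auto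
      qed (use psubset.hyps in simp)
      then obtain y where y: "y \<in> I" "y \<notin> Q" "\<And>P. P \<in> G - {Q} \<Longrightarrow> y \<in> P" by blast
      have c: "x \<in> carrier R" "y \<in> carrier R" using x y ideal_subset[OF I] by auto
      have "x \<oplus> y \<notin> P" if "P \<in> G" for P
      proof (cases "P = Q")
        case True
        then show ?thesis
          using ideal_add_cancel[OF primeideal_ideal[OF Q(1)] c(2) \<open>x \<in> Q\<close>] y(2) c a_comm by metis
      next
        case False
        then have P: "P \<in> G - {Q}" using that by simp
        then have "ideal P R" using psubset.prems[of P] primeideal_ideal[of P] by simp
        then show ?thesis using ideal_add_cancel[OF _ c(1) y(3)[OF P]] x(2)[OF P] by blast
      qed
      then show ?thesis using ideal_add[OF I x(1) y(1)] by blast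
    qed
  qed
qed

text \<open>A prime over \<open>I\<close> that misses the products \<open>s x^n\<close> with
  \<open>s \<notin> P\<close> lies below \<open>P\<close> and omits \<open>x\<close>; such a prime exists because \<open>s x^n \<in> I\<close> would give
  \<open>s \<in> I \<subseteq> P\<close>.\<close>

lemma smaller_prime_of_nonzerodivisor:
  assumes I: "ideal I R" and P: "primeideal P R" "I \<subseteq> P" and x: "x \<in> P"
    and nzd: "\<And>a. a \<in> carrier R \<Longrightarrow> x \<otimes> a \<in> I \<Longrightarrow> a \<in> I"
  obtains Q where "primeideal Q R" "I \<subseteq> Q" "Q \<subset> P"
proof -
  have xc: "x \<in> carrier R" using x ideal_subset[OF primeideal_ideal[OF P(1)]] by blast
  define S where "S = {s \<otimes> x [^] n | s n. s \<in> carrier R - P \<and> n \<in> (UNIV :: nat set)}"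
  have nzd_pow: "a \<in> I" if "a \<in> carrier R" "a \<otimes> x [^] (n::nat) \<in> I" for a n
    using that
  proof (induction n)
    case (Suc n)
    have "a \<otimes> x [^] Suc n = x \<otimes> (a \<otimes> x [^] n)" using Suc.prems(1) xc by (simp add: m_ac)
    then show ?case using Suc nzd[of "a \<otimes> x [^] n"] xc by simp
  qed simp
  have "I \<inter> S = {}" using nzd_pow P(2) unfolding S_def by blast
  moreover have in_S: "s \<otimes> x [^] n \<in> S" if "s \<in> carrier R - P" for s and n :: nat
    using that unfolding S_def by blast
  have one_notin: "\<one> \<in> carrier R - P" using primeideal_one[OF P(1)] by simp
  then have "\<one> \<in> S" using in_S[of \<one> 0] by simp
  moreover have "a \<otimes> b \<in> S" if a: "a \<in> S" and b: "b \<in> S" for a b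
  proof -
    obtain s m where a': "a = s \<otimes> x [^] (m::nat)" "s \<in> carrier R - P" using a unfolding S_def by blast
    obtain t n where b': "b = t \<otimes> x [^] (n::nat)" "t \<in> carrier R - P" using b unfolding S_def by blast
    have "s \<in> carrier R" "t \<in> carrier R" "x [^] m \<in> carrier R" "x [^] n \<in> carrier R"
      using a' b' xc by auto
    then have "a \<otimes> b = (s \<otimes> t) \<otimes> (x [^] m \<otimes> x [^] n)" unfolding a'(1) b'(1) by algebra
    also have "x [^] m \<otimes> x [^] n = x [^] (m + n)" using xc by (rule nat_pow_mult)
    finally show ?thesis using in_S[OF primeideal_mult_notin[OF P(1) a'(2) b'(2)]] by simp
  qed
  ultimately obtain Q where Q: "primeideal Q R" "I \<subseteq> Q" "Q \<inter> S = {}"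
    using prime_avoiding_mult_set[OF I] by metis
  have Qc: "Q \<subseteq> carrier R" using ideal_subset[OF primeideal_ideal[OF Q(1)]] .
  have "Q \<subseteq> P"
  proof
    fix s assume "s \<in> Q"
    then have "s \<notin> S" "s \<in> carrier R" using Q(3) Qc by auto
    then show "s \<in> P" using in_S[of s 0] by auto
  qed
  moreover have "x \<in> S" using in_S[OF one_notin, of 1] xc by simp
  then have "x \<notin> Q" using Q(3) by blast
  ultimately show ?thesis using that[OF Q(1,2)] x by blast
qed

end

section \<open>Dimension, parameters and depth of a local ring\<close>

sublocale noetherian_local_ring \<subseteq> noetherian_cring ..

context noetherian_local_ring
begin

lemma mm_prime: "primeideal \<mm> R"
  using maximalideal_prime[OF maximalideal_mm] .

lemma mm_ideal: "ideal \<mm> R"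
  using primeideal_ideal[OF mm_prime] .

lemma proper_ideal_subset_mm:
  assumes "ideal I R" "\<one> \<notin> I"
  shows "I \<subseteq> \<mm>"
proof -
  let ?T = "\<lambda>J. ideal J R \<and> I \<subseteq> J \<and> \<one> \<notin> J"
  obtain M where M: "ideal M R" "I \<subseteq> M" "\<one> \<notin> M"
    and mx: "\<And>J. ?T J \<Longrightarrow> M \<subseteq> J \<Longrightarrow> J = M"
    using maximal_ideal_with[of ?T I] assms by (metis order_refl)
  have "maximalideal M R"
  proof (rule maximalidealI[OF M(1)])
    show "carrier R \<noteq> M" using M(3) by auto
    show "J = M \<or> J = carrier R" if "ideal J R" "M \<subseteq> J" for J
      using mx[of J] that M(2) ideal.one_imp_carrier[OF that(1)] by (meson order_trans)
  qed
  then show ?thesis using unique_maximalideal M(2) by metis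
qed

lemma prime_subset_mm: "primeideal P R \<Longrightarrow> P \<subseteq> \<mm>"
  using proper_ideal_subset_mm primeideal_ideal primeideal_one by metis

lemma prime_chain_to_mm:
  assumes "prime_chain n Q T"
  shows "\<exists>k\<ge>n. \<exists>Q. prime_chain k Q \<mm>"
proof (cases "T = \<mm>")
  case True
  then show ?thesis using assms by blast
next
  case False
  then have "T \<subset> \<mm>" using prime_subset_mm prime_chain_primes[OF assms] by blast
  then have "prime_chain (Suc n) Q \<mm>" using prime_chain_snoc[OF assms mm_prime] by simp
  then show ?thesis using le_SucI by blast
qed

lemma prime_chains_bounded: "\<exists>b. \<forall>n Q. prime_chain n Q \<mm> \<longrightarrow> n \<le> b"
proof -
  obtain A where A: "A \<subseteq> carrier R" "finite A" "\<mm> = Idl A"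
    using finetely_gen[OF mm_ideal] by blast
  have "n \<le> card A" if "prime_chain n Q \<mm>" for n Q
  proof (rule ccontr)
    assume "\<not> ?thesis"
    then obtain k where "n = card A + Suc k"
      by (metis add_Suc_right less_imp_Suc_add not_le)
    moreover have "A \<subseteq> \<mm>" using A genideal_self by simp
    ultimately have "\<exists>Q'. Q \<subseteq> Q' \<and> A \<subseteq> Q' \<and> prime_chain (Suc k) Q' \<mm>"
      using that by (intro prime_chain_through_set[OF A(2)]) simp_all
    then obtain Q' where Q': "A \<subseteq> Q'" "prime_chain (Suc k) Q' \<mm>" by blast
    then have "Q' \<subset> \<mm>" "ideal Q' R"
      using prime_chain_Suc_psubset prime_chain_primes primeideal_ideal by metis+
    then show False using genideal_minimal[OF _ Q'(1)] A(3) by blast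
  qed
  then show ?thesis by blast
qed

lemma krull_dim_attained:
  obtains d where "krull_dim R = enat d" "\<exists>Q. prime_chain d Q \<mm>"
    "\<And>n Q T. prime_chain n Q T \<Longrightarrow> n \<le> d"
proof -
  let ?N = "{n. \<exists>Q. prime_chain n Q \<mm>}"
  have fin: "finite ?N" using prime_chains_bounded finite_nat_set_iff_bounded_le by auto
  have "0 \<in> ?N" using mm_prime by auto
  then have d: "Max ?N \<in> ?N" using fin Max_in by blast
  have ub: "n \<le> Max ?N" if "prime_chain n Q T" for n Q T
    using prime_chain_to_mm[OF that] Max_ge[OF fin] by (metis (mono_tags, lifting) mem_Collect_eq order_trans)
  have "krull_dim R = Sup {enat n | n. \<exists>Q T. prime_chain n Q T}"
    unfolding krull_dim_def prime_chain_iff_sequence ..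
  also have "\<dots> = enat (Max ?N)"
  proof (rule Sup_eqI)
    show "y \<le> enat (Max ?N)" if "y \<in> {enat n | n. \<exists>Q T. prime_chain n Q T}" for y
      using that ub by auto
    show "enat (Max ?N) \<le> y" if "\<And>z. z \<in> {enat n | n. \<exists>Q T. prime_chain n Q T} \<Longrightarrow> z \<le> y" for y
      using that[of "enat (Max ?N)"] d by blast
  qed
  finally show ?thesis using that d ub by blast
qed

text \<open>Every prime over the first \<open>i\<close> elements has height at least \<open>i\<close>. The next element is chosen
  outside finitely many primes that include all primes minimal over the previous elements, with the
  exception of \<open>\<mm>\<close>. A prime containing the new element as well is then strictly larger than one of
  these, and its height has grown. The exception does no harm, since \<open>\<mm>\<close> has height \<open>d > i\<close> anyway.\<close>

lemma elements_raising_height: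
  assumes d: "prime_chain d Q0 \<mm>" and "i \<le> d"
  shows "\<exists>xs. length xs = i \<and> set xs \<subseteq> \<mm> \<and>
           (\<forall>P. primeideal P R \<longrightarrow> set xs \<subseteq> P \<longrightarrow> (\<exists>Q. prime_chain i Q P))"
  using assms(2)
proof (induction i)
  case 0
  then show ?case by auto
next
  case (Suc i)
  then obtain xs where xs: "length xs = i" "set xs \<subseteq> \<mm>"
    "\<And>P. primeideal P R \<Longrightarrow> set xs \<subseteq> P \<Longrightarrow> \<exists>Q. prime_chain i Q P" by auto
  have xc: "set xs \<subseteq> carrier R" using xs(2) ideal_subset[OF mm_ideal] by blast
  obtain F where F: "finite F" "\<And>Q. Q \<in> F \<Longrightarrow> primeideal Q R \<and> Idl (set xs) \<subseteq> Q"
    "\<And>P. primeideal P R \<Longrightarrow> Idl (set xs) \<subseteq> P \<Longrightarrow> \<exists>Q\<in>F. Q \<subseteq> P"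
    using finitely_many_primes_below[OF genideal_ideal[OF xc]] by metis
  have "\<exists>x\<in>\<mm>. \<forall>P\<in>F - {\<mm>}. x \<notin> P"
  proof (rule prime_avoidance[OF _ mm_ideal])
    show "primeideal P R \<and> \<not> \<mm> \<subseteq> P" if "P \<in> F - {\<mm>}" for P
      using F(2)[of P] that prime_subset_mm[of P] by auto
  qed (use F(1) in simp)
  then obtain x where x: "x \<in> \<mm>" "\<And>P. P \<in> F \<Longrightarrow> P \<noteq> \<mm> \<Longrightarrow> x \<notin> P" by blast
  have "\<exists>Q. prime_chain (Suc i) Q P" if P: "primeideal P R" "set (xs @ [x]) \<subseteq> P" for P
  proof -
    have "Idl (set xs) \<subseteq> P" using genideal_minimal[OF primeideal_ideal[OF P(1)]] P(2) by simp
    then obtain Q where Q: "Q \<in> F" "Q \<subseteq> P" using F(3)[OF P(1)] by blast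
    show ?thesis
    proof (cases "Q = \<mm>")
      case True
      then have "P = \<mm>" using Q(2) prime_subset_mm[OF P(1)] by simp
      moreover have "prime_chain ((d - Suc i) + Suc i) Q0 \<mm>" using d Suc.prems by simp
      ultimately show ?thesis using prime_chain_drop by metis
    next
      case False
      then have "Q \<subset> P" using x(2)[OF Q(1)] P(2) Q(2) by auto
      moreover have "primeideal Q R" "set xs \<subseteq> Q"
        using F(2)[OF Q(1)] genideal_self[OF xc] by auto
      ultimately show ?thesis using prime_chain_snoc[OF _ P(1)] xs(3) by metis
    qed
  qed
  then show ?case using xs(1,2) x(1) by (intro exI[of _ "xs @ [x]"]) auto
qed

text \<open>For \<open>i = d\<close> a prime over the chosen elements has height at least \<open>d\<close>, which forces it to be \<open>\<mm>\<close>;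
  so the radical of the ideal that they generate is \<open>\<mm>\<close>.\<close>

lemma system_of_parameters_exists: "\<exists>xs. system_of_parameters R \<mm> xs"
proof -
  obtain d Q0 where d: "krull_dim R = enat d" "prime_chain d Q0 \<mm>"
    "\<And>n Q T. prime_chain n Q T \<Longrightarrow> n \<le> d"
    using krull_dim_attained by metis
  obtain xs where xs: "length xs = d" "set xs \<subseteq> \<mm>"
    "\<And>P. primeideal P R \<Longrightarrow> set xs \<subseteq> P \<Longrightarrow> \<exists>Q. prime_chain d Q P"
    using elements_raising_height[OF d(2)] by blast
  have xc: "set xs \<subseteq> carrier R" using xs(2) ideal_subset[OF mm_ideal] by blast
  have only: "P = \<mm>" if P: "primeideal P R" "set xs \<subseteq> P" for P
  proof (rule ccontr)
    assume "P \<noteq> \<mm>"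
    then have "P \<subset> \<mm>" using prime_subset_mm[OF P(1)] by blast
    then have "\<exists>Q. prime_chain (Suc d) Q \<mm>"
      using xs(3)[OF P] prime_chain_snoc[OF _ mm_prime] by metis
    then show False using d(3) Suc_n_not_le_n by metis
  qed
  have "ideal_radical R (Idl (set xs)) = \<mm>"
  proof (intro equalityI subsetI)
    fix a assume "a \<in> ideal_radical R (Idl (set xs))"
    then obtain k :: nat where a: "a \<in> carrier R" "a [^] k \<in> Idl (set xs)"
      unfolding ideal_radical_def by blast
    then have "a [^] k \<in> \<mm>" using genideal_minimal[OF mm_ideal xs(2)] by blast
    then show "a \<in> \<mm>" using primeideal_pow_notin[OF mm_prime, of a k] a(1) by blast
  next
    fix a assume a: "a \<in> \<mm>"
    then have ac: "a \<in> carrier R" using ideal_subset[OF mm_ideal] by blast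
    show "a \<in> ideal_radical R (Idl (set xs))"
    proof (rule ccontr)
      assume "\<not> ?thesis"
      then have "Idl (set xs) \<inter> range (\<lambda>k::nat. a [^] k) = {}"
        using ac unfolding ideal_radical_def by auto
      moreover have "\<one> \<in> range (\<lambda>k::nat. a [^] k)" by (metis nat_pow_0 rangeI)
      moreover have "b \<otimes> c \<in> range (\<lambda>k::nat. a [^] k)"
        if bc: "b \<in> range (\<lambda>k::nat. a [^] k)" "c \<in> range (\<lambda>k::nat. a [^] k)" for b c
        using bc nat_pow_mult[OF ac] by auto
      ultimately obtain P where P: "primeideal P R" "Idl (set xs) \<subseteq> P" "P \<inter> range (\<lambda>k::nat. a [^] k) = {}"
        using prime_avoiding_mult_set[OF genideal_ideal[OF xc], of "range (\<lambda>k::nat. a [^] k)"] by metis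
      then have "P = \<mm>" using only genideal_self[OF xc] by blast
      moreover have "a \<in> range (\<lambda>k::nat. a [^] k)" using nat_pow_eone[OF ac] by (metis rangeI)
      ultimately show False using P(3) a by blast
    qed
  qed
  then show ?thesis unfolding system_of_parameters_def using xs d(1) by auto
qed

text \<open>The chain is built downwards from \<open>\<mm>\<close>: below a prime over \<open>x\<^sub>1, \<dots>, x\<^sub>i\<close> there is a strictly
  smaller one over \<open>x\<^sub>1, \<dots>, x\<^bsub>i-1\<^esub>\<close>.\<close>

lemma prime_chain_of_regular_sequence:
  assumes xs: "set xs \<subseteq> \<mm>"
    and reg: "\<And>i a. i < length xs \<Longrightarrow> a \<in> carrier R \<Longrightarrow>
        xs ! i \<otimes> a \<in> Idl (set (take i xs)) \<Longrightarrow> a \<in> Idl (set (take i xs))"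
  shows "\<exists>Q. prime_chain (length xs) Q \<mm>"
proof -
  have "\<exists>Q. set (take (length xs - k) xs) \<subseteq> Q \<and> prime_chain k Q \<mm>" if "k \<le> length xs" for k
    using that
  proof (induction k)
    case 0
    then show ?case using xs mm_prime by auto
  next
    case (Suc k)
    let ?i = "length xs - Suc k"
    have i: "?i < length xs" "length xs - k = Suc ?i" using Suc.prems by auto
    then obtain Q where Q: "set (take (Suc ?i) xs) \<subseteq> Q" "prime_chain k Q \<mm>"
      using Suc by auto
    have Qp: "primeideal Q R" using prime_chain_primes[OF Q(2)] by simp
    have sub: "set (take ?i xs) \<subseteq> Q" "xs ! ?i \<in> Q"
      using Q(1) i(1) by (auto simp: take_Suc_conv_app_nth)
    have c: "set (take ?i xs) \<subseteq> carrier R"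
      using sub(1) ideal_subset[OF primeideal_ideal[OF Qp]] by blast
    obtain Q' where Q': "primeideal Q' R" "Idl (set (take ?i xs)) \<subseteq> Q'" "Q' \<subset> Q"
      using smaller_prime_of_nonzerodivisor[OF genideal_ideal[OF c] Qp
          genideal_minimal[OF primeideal_ideal[OF Qp] sub(1)] sub(2) reg[OF i(1)]] by metis
    then have "prime_chain (Suc k) Q' \<mm>" using Q(2) by auto
    then show ?case using Q'(2) genideal_self[OF c] by blast
  qed
  then show ?thesis by blast
qed

end

section \<open>Tensor products and the closure of a submodule\<close>

text \<open>The generators of \<^const>\<open>tensor_relations\<close>, named in order to reason by rule induction over the
  subgroup that they generate.\<close>

definition tensor_relators ::
    "('a, 'c) ring_scheme \<Rightarrow> ('a, 'b, 'd) module_scheme \<Rightarrow> ('a, 'm, 'e) module_scheme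
      \<Rightarrow> ('b \<times> 'm \<Rightarrow>\<^sub>0 int) set" where
  "tensor_relators R B M =
      {frag_of (b \<oplus>\<^bsub>B\<^esub> b', m) - frag_of (b, m) - frag_of (b', m) | b b' m.
          b \<in> carrier B \<and> b' \<in> carrier B \<and> m \<in> carrier M} \<union>
       {frag_of (b, m \<oplus>\<^bsub>M\<^esub> m') - frag_of (b, m) - frag_of (b, m') | b m m'.
          b \<in> carrier B \<and> m \<in> carrier M \<and> m' \<in> carrier M} \<union>
       {frag_of (r \<odot>\<^bsub>B\<^esub> b, m) - frag_of (b, r \<odot>\<^bsub>M\<^esub> m) | r b m.
          r \<in> carrier R \<and> b \<in> carrier B \<and> m \<in> carrier M}"

lemma tensor_relations_eq_generate:
  "tensor_relations R B M =
     generate (free_Abelian_group (carrier B \<times> carrier M)) (tensor_relators R B M)"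
  unfolding tensor_relations_def tensor_relators_def ..

lemma tensor_relations_add:
  "x \<in> tensor_relations R B M \<Longrightarrow> y \<in> tensor_relations R B M \<Longrightarrow> x + y \<in> tensor_relations R B M"
  unfolding tensor_relations_eq_generate
  using generate.eng[of x "free_Abelian_group (carrier B \<times> carrier M)"] by simp

lemma keys_frag_diff_subset:
  "Poly_Mapping.keys x \<subseteq> S \<Longrightarrow> Poly_Mapping.keys y \<subseteq> S \<Longrightarrow> Poly_Mapping.keys (x - y) \<subseteq> S"
  for x y :: "'x \<Rightarrow>\<^sub>0 int"
  using keys_diff[of x y] by blast

lemma tensor_relators_keys:
  assumes "module R B" "module R M" "x \<in> tensor_relators R B M"
  shows "Poly_Mapping.keys x \<subseteq> carrier B \<times> carrier M"
proof -
  interpret B: module R B by fact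
  interpret M: module R M by fact
  show ?thesis
    using assms(3) unfolding tensor_relators_def
    by (elim UnE CollectE exE conjE; hypsubst)
      (intro keys_frag_diff_subset; simp)+
qed

lemma tensor_relations_uminus:
  assumes "module R B" "module R M" "x \<in> tensor_relations R B M"
  shows "- x \<in> tensor_relations R B M"
proof -
  let ?F = "free_Abelian_group (carrier B \<times> carrier M)"
  have sub: "tensor_relators R B M \<subseteq> carrier ?F"
    using tensor_relators_keys[OF assms(1,2)] by auto
  have sg: "subgroup (tensor_relations R B M) ?F"
    unfolding tensor_relations_eq_generate
    by (rule group.generate_is_subgroup[OF group_free_Abelian_group sub])
  then have "x \<in> carrier ?F" using subgroup.subset assms(3) by blast
  then show ?thesis using subgroup.m_inv_closed[OF sg assms(3)] by simp
qed

lemma tensor_relations_diff: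
  assumes "module R B" "module R M" "x \<in> tensor_relations R B M" "y \<in> tensor_relations R B M"
  shows "x - y \<in> tensor_relations R B M"
  using tensor_relations_add[OF assms(3) tensor_relations_uminus[OF assms(1,2,4)]] by simp

lemma tensor_relations_zero: "0 \<in> tensor_relations R B M"
  unfolding tensor_relations_eq_generate
  using generate.one[of "free_Abelian_group (carrier B \<times> carrier M)"] by simp

lemma tensor_relators_subset: "tensor_relators R B M \<subseteq> tensor_relations R B M"
  unfolding tensor_relations_eq_generate by (auto intro: generate.incl)

lemma tensor_relations_submodule_mono:
  assumes B: "module R B" and M: "module R M" and N: "submodule N R M"
  shows "tensor_relations R B (M\<lparr>carrier := N\<rparr>) \<subseteq> tensor_relations R B M"
proof
  fix x assume "x \<in> tensor_relations R B (M\<lparr>carrier := N\<rparr>)"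
  let ?N = "M\<lparr>carrier := N\<rparr>"
  have modN: "module R ?N" by (rule submodule.submodule_is_module[OF N M])
  have "N \<subseteq> carrier M" using module.submoduleE(1)[OF M N] .
  then have "m \<in> carrier M" if "m \<in> carrier ?N" for m using that by auto
  then have "tensor_relators R B ?N \<subseteq> tensor_relators R B M"
    unfolding tensor_relators_def
    by (intro Un_mono Collect_mono ex_mono conj_mono impI; simp)
  then have rel: "h \<in> tensor_relations R B M" if "h \<in> tensor_relators R B ?N" for h
    using that tensor_relators_subset by blast
  show "x \<in> tensor_relations R B M"
    using \<open>x \<in> tensor_relations R B ?N\<close> unfolding tensor_relations_eq_generate[of R B ?N]
  proof (induction rule: generate.induct)
    case one
    then show ?case by (simp add: tensor_relations_zero)
  next
    case (inv h)
    then show ?case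
      using tensor_relators_keys[OF B modN] tensor_relations_uminus[OF B M rel] by simp
  qed (simp_all add: rel tensor_relations_add)
qed

lemma tensor_class_eqI:
  assumes "module R B" "module R M" "y - x \<in> tensor_relations R B M"
  shows "tensor_class R B M y = tensor_class R B M x"
proof -
  have eq: "tensor_class R B M z = (\<lambda>h. h + z) ` tensor_relations R B M" for z
    unfolding tensor_class_def r_coset_def by auto
  have "h + y = (h + (y - x)) + x" "h + x = (h - (y - x)) + y" for h by simp_all
  then show ?thesis
    unfolding eq using tensor_relations_add[OF _ assms(3)] tensor_relations_diff[OF assms(1,2) _ assms(3)]
    by blast
qed

lemma frag_extend_pairs: "frag_extend (\<lambda>(b, n). frag_of (b, n)) z = z"
  using frag_expansion[of z] by (simp add: case_prod_unfold)

text \<open>For the inclusion of \<open>N\<close> the map \<open>id \<otimes> f\<close> sends the class of \<open>x\<close> to the class of the same formal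
  sum \<open>x\<close>; thus membership in its image can be tested on representatives.\<close>

lemma pure_tensor_in_image:
  assumes B: "module R B" and M: "module R M" and N: "submodule N R M"
    and x: "Poly_Mapping.keys x \<subseteq> carrier B \<times> N" "frag_of (b, u) - x \<in> tensor_relations R B M"
  shows "pure_tensor R B M b u
    \<in> tensor_map R B M (\<lambda>n. n) ` carrier (tensor_product R B (M\<lparr>carrier := N\<rparr>))"
proof -
  let ?N = "M\<lparr>carrier := N\<rparr>"
  let ?C = "tensor_class R B ?N x"
  have C: "?C = (\<lambda>h. h + x) ` tensor_relations R B ?N"
    unfolding tensor_class_def r_coset_def by auto
  have const: "tensor_class R B M z = tensor_class R B M x" if "z \<in> ?C" for z
    using that tensor_relations_submodule_mono[OF B M N] unfolding C
    by (auto intro!: tensor_class_eqI[OF B M])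
  have "x \<in> ?C" unfolding C using tensor_relations_zero by force
  then have "(\<Union>z\<in>?C. tensor_class R B M z) = tensor_class R B M x"
    by (rule UN_constant_eq) (intro ballI const)
  then have "tensor_map R B M (\<lambda>n. n) ?C = tensor_class R B M x"
    unfolding tensor_map_def frag_extend_pairs .
  also have "\<dots> = pure_tensor R B M b u"
    unfolding pure_tensor_def using tensor_class_eqI[OF B M x(2)] by simp
  finally have "pure_tensor R B M b u = tensor_map R B M (\<lambda>n. n) ?C" by simp
  moreover have "?C \<in> carrier (tensor_product R B ?N)"
    unfolding tensor_product_def FactGroup_def RCOSETS_def tensor_class_def using x(1) by auto
  ultimately show ?thesis by blast
qed

text \<open>For every \<open>b\<close>, \<open>b \<otimes> a e = a b \<otimes> e\<close>, and \<open>a b\<close> is a combination of elements \<open>i b'\<close> with \<open>i \<in> I\<close>,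
  for which \<open>i b' \<otimes> e = b' \<otimes> i e\<close> comes from \<open>N\<close>.\<close>

lemma smult_in_module_closure:
  assumes B: "module R B" and M: "module R M" and N: "submodule N R M"
    and I: "I \<subseteq> carrier R" and e: "e \<in> carrier M" "\<And>i. i \<in> I \<Longrightarrow> i \<odot>\<^bsub>M\<^esub> e \<in> N"
    and a: "a \<in> carrier R" "\<And>b. b \<in> carrier B \<Longrightarrow> a \<odot>\<^bsub>B\<^esub> b \<in> ideal_smult R B I"
  shows "a \<odot>\<^bsub>M\<^esub> e \<in> module_closure R B M N"
proof -
  interpret B: module R B by fact
  interpret M: module R M by fact
  let ?rel = "tensor_relations R B M"
  \<comment> \<open>\<open>fromN c\<close>: the tensor \<open>c \<otimes> e\<close> comes from \<open>B \<otimes> N\<close>.\<close>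
  define fromN where "fromN c \<longleftrightarrow>
    (\<exists>x. Poly_Mapping.keys x \<subseteq> carrier B \<times> N \<and> frag_of (c, e) - x \<in> ?rel)" for c
  have add_rel: "frag_of (b \<oplus>\<^bsub>B\<^esub> b', e) - frag_of (b, e) - frag_of (b', e) \<in> ?rel"
    if "b \<in> carrier B" "b' \<in> carrier B" for b b'
    using that e(1) by (intro subsetD[OF tensor_relators_subset]) (auto simp: tensor_relators_def)
  have balanced: "frag_of (r \<odot>\<^bsub>B\<^esub> b, e) - frag_of (b, r \<odot>\<^bsub>M\<^esub> e) \<in> ?rel"
    if "r \<in> carrier R" "b \<in> carrier B" for r b
    using that e(1) by (intro subsetD[OF tensor_relators_subset]) (auto simp: tensor_relators_def)
  have fromN_add: "fromN (b \<oplus>\<^bsub>B\<^esub> b')" if b: "b \<in> carrier B" "b' \<in> carrier B" and f: "fromN b" "fromN b'" for b b'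
  proof -
    obtain x where x: "Poly_Mapping.keys x \<subseteq> carrier B \<times> N" "frag_of (b, e) - x \<in> ?rel"
      using f(1) unfolding fromN_def by blast
    obtain y where y: "Poly_Mapping.keys y \<subseteq> carrier B \<times> N" "frag_of (b', e) - y \<in> ?rel"
      using f(2) unfolding fromN_def by blast
    have "frag_of (b \<oplus>\<^bsub>B\<^esub> b', e) - (x + y) =
      (frag_of (b \<oplus>\<^bsub>B\<^esub> b', e) - frag_of (b, e) - frag_of (b', e))
        + ((frag_of (b, e) - x) + (frag_of (b', e) - y))" by (simp add: algebra_simps)
    then have "frag_of (b \<oplus>\<^bsub>B\<^esub> b', e) - (x + y) \<in> ?rel"
      using tensor_relations_add[OF add_rel[OF b] tensor_relations_add[OF x(2) y(2)]] by (simp only:)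
    moreover have "Poly_Mapping.keys (x + y) \<subseteq> carrier B \<times> N"
      using Poly_Mapping.keys_add[of x y] x(1) y(1) by blast
    ultimately show ?thesis unfolding fromN_def by blast
  qed
  have fromN_smult: "fromN (i \<odot>\<^bsub>B\<^esub> b)" if "i \<in> I" "b \<in> carrier B" for i b
  proof -
    have "Poly_Mapping.keys (frag_of (b, i \<odot>\<^bsub>M\<^esub> e)) \<subseteq> carrier B \<times> N" using e(2) that by simp
    then show ?thesis unfolding fromN_def using balanced[of i b] that I by blast
  qed
  \<comment> \<open>Quantifying over the multiples makes \<open>T\<close> a submodule without a scalar multiplication on tensors.\<close>
  define T where "T = {c \<in> carrier B. \<forall>r\<in>carrier R. fromN (r \<odot>\<^bsub>B\<^esub> c)}"
  have IT: "i \<odot>\<^bsub>B\<^esub> b \<in> T" if "i \<in> I" "b \<in> carrier B" for i b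
  proof -
    have ic: "i \<in> carrier R" using that I by blast
    have "r \<odot>\<^bsub>B\<^esub> (i \<odot>\<^bsub>B\<^esub> b) = i \<odot>\<^bsub>B\<^esub> (r \<odot>\<^bsub>B\<^esub> b)" if "r \<in> carrier R" for r
      using that ic \<open>b \<in> carrier B\<close> by (metis B.smult_assoc1 B.R.m_comm)
    then show ?thesis unfolding T_def using fromN_smult that ic by auto
  qed
  have T_smult: "r \<odot>\<^bsub>B\<^esub> c \<in> T" if "r \<in> carrier R" "c \<in> T" for r c
    using that unfolding T_def by (auto simp flip: B.smult_assoc1)
  have "fromN \<zero>\<^bsub>B\<^esub>"
  proof -
    \<comment> \<open>\<open>0 \<otimes> e = 0\<close>, from additivity at \<open>0 + 0\<close>.\<close>
    have "frag_of (\<zero>\<^bsub>B\<^esub>, e) - 0 = - (frag_of (\<zero>\<^bsub>B\<^esub> \<oplus>\<^bsub>B\<^esub> \<zero>\<^bsub>B\<^esub>, e) - frag_of (\<zero>\<^bsub>B\<^esub>, e) - frag_of (\<zero>\<^bsub>B\<^esub>, e))"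
      by simp
    also have "\<dots> \<in> ?rel" by (intro tensor_relations_uminus[OF B M] add_rel) simp_all
    finally show ?thesis unfolding fromN_def by (intro exI[of _ 0]) simp
  qed
  then have "\<zero>\<^bsub>B\<^esub> \<in> T" unfolding T_def by simp
  moreover have "\<ominus>\<^bsub>B\<^esub> c \<in> T" if "c \<in> T" for c
  proof -
    have "c \<in> carrier B" using that unfolding T_def by simp
    then have "\<ominus>\<^bsub>B\<^esub> c = (\<ominus>\<^bsub>R\<^esub> \<one>\<^bsub>R\<^esub>) \<odot>\<^bsub>B\<^esub> c" by (simp add: B.smult_l_minus)
    then show ?thesis using T_smult[OF _ that, of "\<ominus>\<^bsub>R\<^esub> \<one>\<^bsub>R\<^esub>"] by simp
  qed
  moreover have "c \<oplus>\<^bsub>B\<^esub> c' \<in> T" if "c \<in> T" "c' \<in> T" for c c'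
    using that fromN_add unfolding T_def by (auto simp: B.smult_r_distr)
  ultimately have "submodule T R B"
    using T_smult by (intro B.submoduleI) (auto simp: T_def)
  then have span: "ideal_smult R B I \<subseteq> T"
    unfolding ideal_smult_def submodule_span_def using IT by blast
  have "pure_tensor R B M b (a \<odot>\<^bsub>M\<^esub> e)
      \<in> tensor_map R B M (\<lambda>n. n) ` carrier (tensor_product R B (M\<lparr>carrier := N\<rparr>))"
    if b: "b \<in> carrier B" for b
  proof -
    have "a \<odot>\<^bsub>B\<^esub> b \<in> T" using a(2)[OF b] span by blast
    then have "fromN (\<one>\<^bsub>R\<^esub> \<odot>\<^bsub>B\<^esub> (a \<odot>\<^bsub>B\<^esub> b))" unfolding T_def by blast
    then obtain x where x: "Poly_Mapping.keys x \<subseteq> carrier B \<times> N" "frag_of (a \<odot>\<^bsub>B\<^esub> b, e) - x \<in> ?rel"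
      unfolding fromN_def using a(1) b by auto
    have "frag_of (b, a \<odot>\<^bsub>M\<^esub> e) - x =
      (frag_of (a \<odot>\<^bsub>B\<^esub> b, e) - x) - (frag_of (a \<odot>\<^bsub>B\<^esub> b, e) - frag_of (b, a \<odot>\<^bsub>M\<^esub> e))" by simp
    also have "\<dots> \<in> ?rel" by (rule tensor_relations_diff[OF B M x(2) balanced[OF a(1) b]])
    finally show ?thesis by (rule pure_tensor_in_image[OF B M N x(1)])
  qed
  then show ?thesis unfolding module_closure_def using a(1) e(1) by simp
qed

section \<open>Cyclic modules and copies of the ring\<close>

lemma quotient_module_smult_coset:
  assumes M: "module R M" and N: "submodule N R M" and r: "r \<in> carrier R" and x: "x \<in> carrier M"
  shows "r \<odot>\<^bsub>quotient_module M N\<^esub> (N +>\<^bsub>M\<^esub> x) = N +>\<^bsub>M\<^esub> (r \<odot>\<^bsub>M\<^esub> x)"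
proof -
  interpret M: module R M by fact
  have sg: "subgroup N (add_monoid M)" using N by (rule submodule.axioms(1))
  have Nc: "N \<subseteq> carrier M" using M.submoduleE(1)[OF N] .
  have const: "N +>\<^bsub>M\<^esub> (r \<odot>\<^bsub>M\<^esub> y) = N +>\<^bsub>M\<^esub> (r \<odot>\<^bsub>M\<^esub> x)" if y: "y \<in> N +>\<^bsub>M\<^esub> x" for y
  proof -
    obtain n where n: "n \<in> N" "y = n \<oplus>\<^bsub>M\<^esub> x" using y unfolding a_r_coset_def' by blast
    then have "n \<in> carrier M" using Nc by blast
    then have "r \<odot>\<^bsub>M\<^esub> y = (r \<odot>\<^bsub>M\<^esub> n) \<oplus>\<^bsub>M\<^esub> (r \<odot>\<^bsub>M\<^esub> x)" using n(2) r x M.smult_r_distr by simp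
    moreover have "r \<odot>\<^bsub>M\<^esub> n \<in> N" using M.submoduleE(4)[OF N r n(1)] .
    ultimately have "r \<odot>\<^bsub>M\<^esub> y \<in> N +>\<^bsub>M\<^esub> (r \<odot>\<^bsub>M\<^esub> x)" unfolding a_r_coset_def' by blast
    then show ?thesis using M.a_repr_independence[OF _ _ sg] r x by (metis M.smult_closed)
  qed
  have "\<zero>\<^bsub>M\<^esub> \<in> N" using subgroup.one_closed[OF sg] by simp
  then have "x \<in> N +>\<^bsub>M\<^esub> x" using M.a_rcosI[OF _ Nc x] M.l_zero[OF x] by metis
  then have "(\<Union>y\<in>N +>\<^bsub>M\<^esub> x. N +>\<^bsub>M\<^esub> (r \<odot>\<^bsub>M\<^esub> y)) = N +>\<^bsub>M\<^esub> (r \<odot>\<^bsub>M\<^esub> x)"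
    by (rule UN_constant_eq) (intro ballI const)
  then show ?thesis unfolding quotient_module_def by simp
qed

lemma subgroup_record_cong:
  assumes "subgroup K G" "carrier G = carrier H" "monoid.mult G = monoid.mult H" "one G = one H"
  shows "subgroup K H"
  using assms unfolding subgroup_def m_inv_def by simp

text \<open>The coset of a generator \<open>e\<close> of \<open>M\<close> generates the quotient.\<close>

lemma fin_gen_quotient_of_cyclic:
  assumes M: "module R M" and N: "submodule N R M"
    and e: "e \<in> carrier M" "\<And>m. m \<in> carrier M \<Longrightarrow> \<exists>r\<in>carrier R. m = r \<odot>\<^bsub>M\<^esub> e"
  shows "fin_gen_module R (quotient_module M N)"
proof -
  interpret M: module R M by fact
  let ?Q = "quotient_module M N"
  have sg: "subgroup N (add_monoid M)" using N by (rule submodule.axioms(1))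
  interpret N: abelian_subgroup N M
    by (rule abelian_subgroupI3[OF additive_subgroup.intro[OF sg] M.abelian_group_axioms])
  have carr: "carrier ?Q = {N +>\<^bsub>M\<^esub> m | m. m \<in> carrier M}"
    unfolding quotient_module_def A_RCOSETS_def' by auto
  have "subgroup (carrier (M A_Mod N)) (M A_Mod N)"
    using group.subgroup_self[OF N.a_factorgroup_is_group] .
  moreover have "carrier (M A_Mod N) = carrier ?Q"
    unfolding quotient_module_def A_FactGroup_def FactGroup_def A_RCOSETS_def by simp
  ultimately have "subgroup (carrier ?Q) (M A_Mod N)" by simp
  then have "subgroup (carrier ?Q) (add_monoid ?Q)"
    by (rule subgroup_record_cong)
      (simp_all add: quotient_module_def A_FactGroup_def FactGroup_def A_RCOSETS_def set_add_def fun_eq_iff)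
  then have sub: "submodule (carrier ?Q) R ?Q"
  proof (rule submodule.intro, unfold_locales)
    fix r C assume r: "r \<in> carrier R" and "C \<in> carrier ?Q"
    then obtain m where "m \<in> carrier M" "C = N +>\<^bsub>M\<^esub> m" unfolding carr by blast
    then show "r \<odot>\<^bsub>?Q\<^esub> C \<in> carrier ?Q"
      unfolding carr using quotient_module_smult_coset[OF M N r] M.smult_closed[OF r] by blast
  qed
  have e_in: "N +>\<^bsub>M\<^esub> e \<in> carrier ?Q" unfolding carr using e(1) by blast
  have least: "carrier ?Q \<subseteq> K" if K: "submodule K R ?Q" "N +>\<^bsub>M\<^esub> e \<in> K" for K
  proof
    fix C assume "C \<in> carrier ?Q"
    then obtain m where m: "m \<in> carrier M" "C = N +>\<^bsub>M\<^esub> m" unfolding carr by blast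
    obtain r where r: "r \<in> carrier R" "m = r \<odot>\<^bsub>M\<^esub> e" using e(2)[OF m(1)] by blast
    have "C = r \<odot>\<^bsub>?Q\<^esub> (N +>\<^bsub>M\<^esub> e)"
      unfolding m(2) r(2) using quotient_module_smult_coset[OF M N r(1) e(1)] by simp
    then show "C \<in> K" using submodule.smult_closed[OF K(1) r(1) K(2)] by simp
  qed
  have "submodule_span R ?Q {N +>\<^bsub>M\<^esub> e} = carrier ?Q"
    unfolding submodule_span_def
  proof (rule antisym)
    show "\<Inter>{K. submodule K R ?Q \<and> {N +>\<^bsub>M\<^esub> e} \<subseteq> K} \<subseteq> carrier ?Q"
      using sub e_in by (intro Inter_lower) simp
    show "carrier ?Q \<subseteq> \<Inter>{K. submodule K R ?Q \<and> {N +>\<^bsub>M\<^esub> e} \<subseteq> K}"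
      by (rule Inter_greatest) (use least in simp)
  qed
  then show ?thesis
    unfolding fin_gen_module_def using e_in by (intro exI[of _ "{N +>\<^bsub>M\<^esub> e}"]) simp
qed

lemma smult_mem_ideal_smult:
  assumes "a \<in> I" "b \<in> carrier B"
  shows "a \<odot>\<^bsub>B\<^esub> b \<in> ideal_smult R B I"
  unfolding ideal_smult_def submodule_span_def using assms by blast

text \<open>The module \<open>R\<close>, copied along an injection \<open>g\<close> into a given type: the test ideals range over modules
  with elements in a type \<open>'m\<close>, to which \<open>R\<close> itself need not belong. The ring operations
  \<open>monoid.mult\<close> and \<open>monoid.one\<close> of the record carry no meaning for a module.\<close>

definition renamed_ring_module :: "('a \<Rightarrow> 'm) \<Rightarrow> ('a, 'c) ring_scheme \<Rightarrow> ('a, 'm) module" where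
  "renamed_ring_module g R =
     \<lparr>carrier = g ` carrier R, monoid.mult = undefined, monoid.one = undefined,
      ring.zero = g \<zero>\<^bsub>R\<^esub>, ring.add = (\<lambda>x y. g (inv_into UNIV g x \<oplus>\<^bsub>R\<^esub> inv_into UNIV g y)),
      module.smult = (\<lambda>r x. g (r \<otimes>\<^bsub>R\<^esub> inv_into UNIV g x))\<rparr>"

context cring
begin

lemma renamed_ring_module_is_module:
  assumes "inj g"
  shows "module R (renamed_ring_module g R)"
proof (rule moduleI)
  note [simp] = inv_f_f[OF assms] renamed_ring_module_def
  show "abelian_group (renamed_ring_module g R)"
  proof (rule abelian_groupI)
    fix x assume "x \<in> carrier (renamed_ring_module g R)"
    then obtain a where "a \<in> carrier R" "x = g a" by auto
    then show "\<exists>y\<in>carrier (renamed_ring_module g R).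
        y \<oplus>\<^bsub>renamed_ring_module g R\<^esub> x = \<zero>\<^bsub>renamed_ring_module g R\<^esub>"
      by (auto intro!: bexI[of _ "\<ominus> a"] simp: l_neg)
  qed (auto simp: a_ac)
qed (auto simp: is_cring inv_f_f[OF assms] renamed_ring_module_def l_distr r_distr m_assoc)

lemma renamed_ideal_is_submodule:
  assumes g: "inj g" and I: "ideal I R"
  shows "submodule (g ` I) R (renamed_ring_module g R)"
proof -
  interpret M: module R "renamed_ring_module g R" by (rule renamed_ring_module_is_module[OF g])
  have smult: "r \<odot>\<^bsub>renamed_ring_module g R\<^esub> x \<in> g ` I" if "r \<in> carrier R" "x \<in> g ` I" for r x
    using that ideal_mult[OF I] by (auto simp: renamed_ring_module_def inv_f_f[OF g])
  have sub: "g ` I \<subseteq> carrier (renamed_ring_module g R)"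
    using ideal_subset[OF I] by (auto simp: renamed_ring_module_def)
  show ?thesis
  proof (rule M.submoduleI[OF sub])
    show "\<ominus>\<^bsub>renamed_ring_module g R\<^esub> x \<in> g ` I" if "x \<in> g ` I" for x
    proof -
      have "x \<in> carrier (renamed_ring_module g R)" using sub that by blast
      then have "\<ominus>\<^bsub>renamed_ring_module g R\<^esub> x = (\<ominus> \<one>) \<odot>\<^bsub>renamed_ring_module g R\<^esub> x"
        by (simp add: M.smult_l_minus)
      then show ?thesis using smult[OF _ that, of "\<ominus> \<one>"] by simp
    qed
  qed (use smult ideal_zero[OF I] ideal_add[OF I] in \<open>auto simp: renamed_ring_module_def inv_f_f[OF g]\<close>)
qed

lemma ideal_smult_ring_as_module:
  assumes I: "ideal I R"
  shows "ideal_smult R (ring_as_module R) I = I"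
proof
  have "subgroup I (add_monoid (ring_as_module R))"
    using additive_subgroup.a_subgroup[OF ideal.axioms(1)[OF I]]
    by (rule subgroup_record_cong) (simp_all add: ring_as_module_def)
  then have "submodule I R (ring_as_module R)"
    using ideal_mult[OF I]
    by (auto intro!: submodule.intro submodule_axioms.intro simp: ring_as_module_def)
  moreover have "{a \<odot>\<^bsub>ring_as_module R\<^esub> m | a m. a \<in> I \<and> m \<in> carrier (ring_as_module R)} \<subseteq> I"
    using ideal.I_r_closed[OF I] by (auto simp: ring_as_module_def)
  ultimately show "ideal_smult R (ring_as_module R) I \<subseteq> I"
    unfolding ideal_smult_def submodule_span_def by blast
  have "i = i \<odot>\<^bsub>ring_as_module R\<^esub> \<one> \<and> \<one> \<in> carrier (ring_as_module R)" if "i \<in> I" for i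
    using that ideal_subset[OF I] by (auto simp: ring_as_module_def)
  then show "I \<subseteq> ideal_smult R (ring_as_module R) I"
    unfolding ideal_smult_def submodule_span_def by blast
qed

lemma regular_sequence_ring_iff:
  "regular_sequence R (ring_as_module R) xs \<longleftrightarrow>
     set xs \<subseteq> carrier R \<and>
     (\<forall>i<length xs. \<forall>a\<in>carrier R.
        xs ! i \<otimes> a \<in> Idl (set (take i xs)) \<longrightarrow> a \<in> Idl (set (take i xs))) \<and>
     Idl (set xs) \<noteq> carrier R"
proof (cases "set xs \<subseteq> carrier R")
  case True
  then have "set (take i xs) \<subseteq> carrier R" for i using set_take_subset by (rule order_trans[rotated])
  then have "ideal_smult R (ring_as_module R) (Idl (set (take i xs))) = Idl (set (take i xs))" for i
    using ideal_smult_ring_as_module genideal_ideal by blast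
  moreover have "ideal_smult R (ring_as_module R) (Idl (set xs)) = Idl (set xs)"
    using ideal_smult_ring_as_module genideal_ideal[OF True] by blast
  moreover have "carrier (ring_as_module R) = carrier R"
    "x \<odot>\<^bsub>ring_as_module R\<^esub> a = x \<otimes> a" for x a by (simp_all add: ring_as_module_def)
  ultimately show ?thesis unfolding regular_sequence_def by simp
qed (simp add: regular_sequence_def)

section \<open>From test ideals to depth\<close>

text \<open>The test ideal contains \<open>1\<close>, so the copy of \<open>I\<close> in the copy of \<open>R\<close> is closed; and the copy of \<open>a\<close>,
  which is \<open>a\<close> times the copy of \<open>1\<close>, belongs to its closure.\<close>

lemma ideals_closed_if_test_ideal_trivial:
  fixes B :: "('a, 'n) module"
  assumes B: "module R B" and inj: "\<exists>f :: 'a + 'n + nat \<Rightarrow> 'm. inj f"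
    and triv: "test_ideal TYPE('m) R B = carrier R \<or> fg_test_ideal TYPE('m) R B = carrier R"
    and I: "ideal I R" and a: "a \<in> carrier R"
    and aB: "\<And>b. b \<in> carrier B \<Longrightarrow> a \<odot>\<^bsub>B\<^esub> b \<in> ideal_smult R B I"
  shows "a \<in> I"
proof -
  obtain f :: "'a + 'n + nat \<Rightarrow> 'm" where "inj f" using inj by blast
  then have g: "inj (f \<circ> Inl)" by (intro inj_compose) simp_all
  define g where "g = f \<circ> Inl"
  let ?M = "renamed_ring_module g R"
  have g: "inj g" using g unfolding g_def .
  note M = renamed_ring_module_is_module[OF g] and N = renamed_ideal_is_submodule[OF g I]
  have smult_e: "r \<odot>\<^bsub>?M\<^esub> g \<one> = g r" if "r \<in> carrier R" for r
    using that by (simp add: renamed_ring_module_def inv_f_f[OF g])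
  have e: "g \<one> \<in> carrier ?M" by (simp add: renamed_ring_module_def)
  have "fin_gen_module R (quotient_module ?M (g ` I))"
  proof (rule fin_gen_quotient_of_cyclic[OF M N e])
    fix m assume "m \<in> carrier ?M"
    then obtain r where "r \<in> carrier R" "m = g r" by (auto simp: renamed_ring_module_def)
    then show "\<exists>r\<in>carrier R. m = r \<odot>\<^bsub>?M\<^esub> g \<one>" using smult_e by metis
  qed
  then have "fg_test_ideal TYPE('m) R B \<subseteq> module_colon R ?M (g ` I) (module_closure R B ?M (g ` I))"
    "test_ideal TYPE('m) R B \<subseteq> module_colon R ?M (g ` I) (module_closure R B ?M (g ` I))"
    unfolding fg_test_ideal_def test_ideal_def using M N by blast+
  then have one: "\<one> \<in> module_colon R ?M (g ` I) (module_closure R B ?M (g ` I))"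
    using triv one_closed by blast
  have "a \<odot>\<^bsub>?M\<^esub> g \<one> \<in> module_closure R B ?M (g ` I)"
    using smult_in_module_closure[OF B M N ideal_subset[OF I] e _ a aB] smult_e ideal_subset[OF I]
    by blast
  then have "\<one> \<odot>\<^bsub>?M\<^esub> (a \<odot>\<^bsub>?M\<^esub> g \<one>) \<in> g ` I" using one unfolding module_colon_def by blast
  moreover have "\<one> \<odot>\<^bsub>?M\<^esub> (a \<odot>\<^bsub>?M\<^esub> g \<one>) = g a"
    using a by (simp add: renamed_ring_module_def inv_f_f[OF g])
  ultimately show ?thesis using inj_image_mem_iff[OF g] by metis
qed

end

lemma (in noetherian_local_ring) local_depth_le_krull_dim: "local_depth R \<mm> \<le> krull_dim R"
  unfolding local_depth_def
proof (rule Sup_least)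
  fix n assume "n \<in> {enat (length xs) |xs. set xs \<subseteq> \<mm> \<and> regular_sequence R (ring_as_module R) xs}"
  then obtain xs where xs: "n = enat (length xs)" "set xs \<subseteq> \<mm>"
    "regular_sequence R (ring_as_module R) xs" by blast
  then have "\<exists>Q. prime_chain (length xs) Q \<mm>"
    using prime_chain_of_regular_sequence[OF xs(2)] unfolding regular_sequence_ring_iff by blast
  then show "n \<le> krull_dim R" using krull_dim_attained xs(1) by (metis enat_ord_simps(1))
qed

theorem corollary3p6:
  fixes R :: "('a, 'c) ring_scheme" and \<mm> :: "'a set" and B :: "('a, 'b) module"
  assumes "noetherian_local_ring R \<mm>"
    and "domain R"
    and "big_cohen_macaulay R \<mm> B"
    and "\<exists>f :: 'a + 'b + nat \<Rightarrow> 'm. inj f"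
    and "test_ideal TYPE('m) R B = carrier R \<or> fg_test_ideal TYPE('m) R B = carrier R"
  shows "cohen_macaulay_local R \<mm>"
proof -
  interpret noetherian_local_ring R \<mm> by fact
  have B: "module R B" using assms(3) unfolding big_cohen_macaulay_def by blast
  interpret B: module R B by fact
  obtain xs where sop: "system_of_parameters R \<mm> xs" using system_of_parameters_exists by blast
  then have xs: "set xs \<subseteq> \<mm>" "enat (length xs) = krull_dim R"
    unfolding system_of_parameters_def by auto
  have xc: "set xs \<subseteq> carrier R" using xs(1) ideal_subset[OF mm_ideal] by blast
  have regB: "regular_sequence R B xs" using assms(3) sop unfolding big_cohen_macaulay_def by blast
  have "a \<in> Idl\<^bsub>R\<^esub> (set (take i xs))"
    if i: "i < length xs" and a: "a \<in> carrier R" and xa: "xs ! i \<otimes>\<^bsub>R\<^esub> a \<in> Idl\<^bsub>R\<^esub> (set (take i xs))" for i a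
  proof -
    have I: "ideal (Idl\<^bsub>R\<^esub> (set (take i xs))) R"
      using xc set_take_subset by (intro genideal_ideal) (rule order_trans)
    show ?thesis
    proof (rule ideals_closed_if_test_ideal_trivial[OF B assms(4,5) I a])
      fix b assume b: "b \<in> carrier B"
      have "xs ! i \<in> carrier R" using xc i nth_mem by blast
      then have "xs ! i \<odot>\<^bsub>B\<^esub> (a \<odot>\<^bsub>B\<^esub> b) = (xs ! i \<otimes>\<^bsub>R\<^esub> a) \<odot>\<^bsub>B\<^esub> b"
        using B.smult_assoc1 a b by simp
      also have "\<dots> \<in> ideal_smult R B (Idl\<^bsub>R\<^esub> (set (take i xs)))"
        by (rule smult_mem_ideal_smult[OF xa b])
      finally show "a \<odot>\<^bsub>B\<^esub> b \<in> ideal_smult R B (Idl\<^bsub>R\<^esub> (set (take i xs)))"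
        using regB i B.smult_closed[OF a b] unfolding regular_sequence_def by blast
    qed
  qed
  moreover have "Idl\<^bsub>R\<^esub> (set xs) \<noteq> carrier R"
    using genideal_minimal[OF mm_ideal xs(1)] primeideal_one[OF mm_prime] by blast
  ultimately have "regular_sequence R (ring_as_module R) xs"
    unfolding regular_sequence_ring_iff using xc by blast
  then have "krull_dim R \<le> local_depth R \<mm>"
    unfolding local_depth_def xs(2)[symmetric] using xs(1) by (intro Sup_upper) blast
  then show ?thesis
    unfolding cohen_macaulay_local_def
    using local_depth_le_krull_dim assms(1) by (simp add: antisym)
qed

end
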